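(* Let $n\ge 1$, let $\Phi_n$ be a root system of type B, C, or D, and let $X$ be one of $\mathbb{C}$, $\mathbb{C}^\times$, or a complex elliptic curve. Let $\mathcal{A}_n=\mathcal{A}(X,\Phi_n^+)$ be the corresponding arrangement in $X^n$ and let $\mathcal{C}_n=\mathcal{C}(X,\Phi_n)$ be the corresponding set of labelled partitions. Then there is a $W_n$-equivariant isomorphism of ranked posets between $\mathcal{C}_n$ and the poset of layers of $\mathcal{A}_n$.
   Context: **Arrangements.** $X$ is regarded as an abelian group written multiplicatively, with identity $e$ (for $X=\mathbb{C}$ the operation is addition, $e=0$ and $x^{-1}$ means $-x$). $X[2]$ is the set of two-torsion points of $X$, i.e. $z$ with $z=z^{-1}$ (of cardinality $1,2,4$ for $\mathbb{C}$, $\mathbb{C}^\times$, elliptic curve respectively). For $1\le i<j\le n$ and $z\in X[2]$ put $H_{ij}=\{x\in X^n: x_i=x_j\}$, $H'_{ij}=\{x\in X^n: x_i=x_j^{-1}\}$, $H_i^z=\{x\in X^n: x_i=z\}$ (for $1\le i\le n$). The arrangement $\mathcal{A}(X,\Phi_n^+)$ consists of: - type C: all $H_{ij}$, $H'_{ij}$ ($1\le i<j\le n$), and all $H_i^z$ ($1\le i\le n$, $z\in X[2]$); - type B: all $H_{ij}$, $H'_{ij}$, and $H_i^e$ ($1\le i\le n$); - type D: all $H_{ij}$ and $H'_{ij}$. A *layer* of an arrangement $\mathcal{A}$ is a connected component of an intersection $\bigcap_{H\in S}H$ for some $S\subseteq\mathcal{A}$ (the empty intersection being $X^n$). Layers are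 ordered by reverse inclusion, with rank equal to complex codimension in $X^n$. **Labelled partitions.** Let $\mathbf{n}=\{1,\bar1,2,\bar2,\dots,n,\bar n\}$, with $\bar{\bar k}=k$, and for $S\subseteq\mathbf{n}$ let $\bar S=\{\bar x: x\in S\}$. A partition of a set labelled by a set $L$ is a partition $\Sigma$ of the set (into nonempty parts) together with a subset $T\subseteq\Sigma$ (the labelled parts) and an injection $f:T\to L$; the part labelled by $z$ is written $\Sigma_z$, with $\Sigma_z=\emptyset$ if $z$ is not in the image of $f$. Let $\mathcal{P}_n(X)$ be the set of partitions $\Sigma$ of $\mathbf{n}$ labelled by $X[2]$ such that (i) $S\in\Sigma$ implies $\bar S\in\Sigma$, and (ii) for $S\in\Sigma$, $S=\bar S$ if and only if $S$ is labelled. Then $\mathcal{C}(X,\Phi_n)\subseteq\mathcal{P}_n(X)$ is: - type C: $\mathcal{P}_n(X)$; - type B: all $\Sigma\in\mathcal{P}_n(X)$ such that $|\Sigma_z|=2$ implies $z=e$; - type D: all $\Sigma\in\mathcal{P}_n(X)$ such that $|\Sigma_z|\ne 2$ for all $z\in X[2]$. Order: $\Sigma\le\Sigma'$ if $\Sigma$ is a refinement of $\Sigma'$ and $\Sigma_z\subseteq\Sigma'_z$ for every $z\in X[2]$. Rank: $\operatorname{rk}(\Sigma)=n-\ell/2$, where $\ell$ is the number of unlabelled parts of $\Sigma$. **Group actions.** $W_n=(\mathbb{Z}/2)^n\rtimes S_n$ is the hyperoctahedral group, with $\mathbb{Z}/2=\{\pm1\}$. For $w=(\sigma,\epsilon)$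 with $\sigma\in S_n$, $\epsilon\in\{\pm1\}^n$, and $x\in X^n$, the point $w\cdot x$ has $\sigma(i)$-th coordinate $x_i^{\epsilon_i}$; this permutes the subvarieties in each of the arrangements and hence the layers. On $\mathbf{n}$: for $k\in\{1,\dots,n\}$, $w\cdot k=\sigma(k)$ if $\epsilon_k=1$ and $w\cdot k=\overline{\sigma(k)}$ if $\epsilon_k=-1$, and $w\cdot\bar k=\overline{w\cdot k}$; this induces an action on labelled partitions with $(w\cdot\Sigma)_z=w\cdot(\Sigma_z)$. *)

theory Defs
  imports
    "HOL-Analysis.Analysis"
    "HOL-Algebra.Coset"
    "HOL-Combinatorics.Permutations"
    "HOL-Library.Disjoint_Sets"
begin

section \<open>The groups \<open>\<complex>\<close>, \<open>\<complex>\<^sup>\<times>\<close> and complex elliptic curves\<close>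

text \<open>
  A one-dimensional complex Lie group: an abelian group written multiplicatively, its topology, and
  its complex structure.  The latter is given by local parametrisations \<open>(V, \<phi>)\<close>, with \<open>V\<close> open in
  the complex plane and \<open>\<phi>\<close> a biholomorphism from \<open>V\<close> onto an open subset of the curve
  (that is, \<open>\<phi>\<close> is the inverse of a chart).
\<close>

record 'a curve_group = "'a monoid" +
  curve_top :: "'a topology"
  params :: "(complex set \<times> (complex \<Rightarrow> 'a)) set"

definition additive_line :: "complex curve_group" where
  "additive_line =
     \<lparr>carrier = UNIV, monoid.mult = (+), one = 0,
      curve_top = euclidean, params = {(UNIV, \<lambda>z. z)}\<rparr>"

definition punctured_line :: "complex curve_group" where
  "punctured_line =
     \<lparr>carrier = - {0}, monoid.mult = (*), one = 1,
      curve_top = top_of_set (- {0}), params = {(- {0}, \<lambda>z. z)}\<rparr>"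

definition quotient_topology :: "'a topology \<Rightarrow> ('a \<Rightarrow> 'b) \<Rightarrow> 'b topology" where
  "quotient_topology T f =
     topology (\<lambda>U. U \<subseteq> f ` topspace T \<and> openin T {x \<in> topspace T. f x \<in> U})"

lemma openin_quotient_topology:
  "openin (quotient_topology T f) U \<longleftrightarrow>
     U \<subseteq> f ` topspace T \<and> openin T {x \<in> topspace T. f x \<in> U}"
proof -
  have "istopology (\<lambda>U. U \<subseteq> f ` topspace T \<and> openin T {x \<in> topspace T. f x \<in> U})"
    unfolding istopology_def
  proof (rule conjI; intro allI impI)
    fix S U
    assume "S \<subseteq> f ` topspace T \<and> openin T {x \<in> topspace T. f x \<in> S}"
      and "U \<subseteq> f ` topspace T \<and> openin T {x \<in> topspace T. f x \<in> U}"
    moreover have "{x \<in> topspace T. f x \<in> S \<inter> U} =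
        {x \<in> topspace T. f x \<in> S} \<inter> {x \<in> topspace T. f x \<in> U}"
      by blast
    ultimately show "S \<inter> U \<subseteq> f ` topspace T \<and> openin T {x \<in> topspace T. f x \<in> S \<inter> U}"
      by auto
  next
    fix \<U>
    assume *: "\<forall>U\<in>\<U>. U \<subseteq> f ` topspace T \<and> openin T {x \<in> topspace T. f x \<in> U}"
    have "{x \<in> topspace T. f x \<in> \<Union>\<U>} = (\<Union>U\<in>\<U>. {x \<in> topspace T. f x \<in> U})"
      by blast
    moreover have "openin T (\<Union>U\<in>\<U>. {x \<in> topspace T. f x \<in> U})"
      using * by (intro openin_Union) blast
    ultimately show "\<Union>\<U> \<subseteq> f ` topspace T \<and> openin T {x \<in> topspace T. f x \<in> \<Union>\<U>}"
      using * by (metis Union_least)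
  qed
  then show ?thesis
    by (simp add: quotient_topology_def topology_inverse')
qed

definition complex_group :: "complex monoid" where
  "complex_group = \<lparr>carrier = UNIV, monoid.mult = (+), one = 0\<rparr>"

definition period_lattice :: "complex \<Rightarrow> complex \<Rightarrow> complex set" where
  "period_lattice \<omega>1 \<omega>2 = {of_int a * \<omega>1 + of_int b * \<omega>2 | a b. True}"

abbreviation lattice_proj :: "complex set \<Rightarrow> complex \<Rightarrow> complex set" where
  "lattice_proj \<Lambda> z \<equiv> \<Lambda> #>\<^bsub>complex_group\<^esub> z"

text \<open>
  A complex elliptic curve is \<open>\<complex>/\<Lambda>\<close> for a lattice \<open>\<Lambda>\<close>, with the quotient group structure and
  topology; its local parametrisations are the restrictions of the projection to open sets on which
  it is injective.  The set \<open>period_lattice \<omega>1 \<omega>2\<close> is a lattice iff \<open>\<omega>2 / \<omega>1 \<notin> \<real>\<close> (as division by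
  zero yields zero, this includes \<open>\<omega>1 \<noteq> 0\<close>).
\<close>

definition elliptic_curve :: "complex set \<Rightarrow> complex set curve_group" where
  "elliptic_curve \<Lambda> =
     \<lparr>carrier = carrier (complex_group Mod \<Lambda>),
      monoid.mult = monoid.mult (complex_group Mod \<Lambda>),
      one = one (complex_group Mod \<Lambda>),
      curve_top = quotient_topology euclidean (lattice_proj \<Lambda>),
      params = {(V, lattice_proj \<Lambda>) | V. open V \<and> inj_on (lattice_proj \<Lambda>) V}\<rparr>"

definition two_torsion :: "('a, 'm) monoid_scheme \<Rightarrow> 'a set" where
  "two_torsion X = {z \<in> carrier X. z = inv\<^bsub>X\<^esub> z}"


section \<open>Arrangements and their layers\<close>

definition cartesian_power :: "('a, 'm) monoid_scheme \<Rightarrow> nat \<Rightarrow> (nat \<Rightarrow> 'a) set" where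
  "cartesian_power X n = {1..n} \<rightarrow>\<^sub>E carrier X"

definition power_top :: "('a, 'm) curve_group_scheme \<Rightarrow> nat \<Rightarrow> (nat \<Rightarrow> 'a) topology" where
  "power_top X n = product_topology (\<lambda>_. curve_top X) {1..n}"

datatype root_type = TypeB | TypeC | TypeD

definition H_eq :: "('a, 'm) monoid_scheme \<Rightarrow> nat \<Rightarrow> nat \<Rightarrow> nat \<Rightarrow> (nat \<Rightarrow> 'a) set" where
  "H_eq X n i j = {x \<in> cartesian_power X n. x i = x j}"

definition H_inv :: "('a, 'm) monoid_scheme \<Rightarrow> nat \<Rightarrow> nat \<Rightarrow> nat \<Rightarrow> (nat \<Rightarrow> 'a) set" where
  "H_inv X n i j = {x \<in> cartesian_power X n. x i = inv\<^bsub>X\<^esub> (x j)}"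

definition H_pt :: "('a, 'm) monoid_scheme \<Rightarrow> nat \<Rightarrow> nat \<Rightarrow> 'a \<Rightarrow> (nat \<Rightarrow> 'a) set" where
  "H_pt X n i z = {x \<in> cartesian_power X n. x i = z}"

definition pair_part :: "('a, 'm) monoid_scheme \<Rightarrow> nat \<Rightarrow> (nat \<Rightarrow> 'a) set set" where
  "pair_part X n = {H_eq X n i j | i j. 1 \<le> i \<and> i < j \<and> j \<le> n}
                 \<union> {H_inv X n i j | i j. 1 \<le> i \<and> i < j \<and> j \<le> n}"

fun arrangement :: "('a, 'm) monoid_scheme \<Rightarrow> root_type \<Rightarrow> nat \<Rightarrow> (nat \<Rightarrow> 'a) set set" where
  "arrangement X TypeC n = pair_part X n \<union> {H_pt X n i z | i z. i \<in> {1..n} \<and> z \<in> two_torsion X}"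
| "arrangement X TypeB n = pair_part X n \<union> {H_pt X n i \<one>\<^bsub>X\<^esub> | i. i \<in> {1..n}}"
| "arrangement X TypeD n = pair_part X n"

definition layers :: "('a, 'm) curve_group_scheme \<Rightarrow> root_type \<Rightarrow> nat \<Rightarrow> (nat \<Rightarrow> 'a) set set" where
  "layers X R n =
     (\<Union>S\<in>Pow (arrangement X R n).
        connected_components_of (subtopology (power_top X n) (cartesian_power X n \<inter> \<Inter>S)))"

definition layer_le :: "(nat \<Rightarrow> 'a) set \<Rightarrow> (nat \<Rightarrow> 'a) set \<Rightarrow> bool" where
  "layer_le K L \<longleftrightarrow> L \<subseteq> K"


section \<open>Complex codimension\<close>

definition Cn :: "nat \<Rightarrow> (nat \<Rightarrow> complex) topology" where
  "Cn n = product_topology (\<lambda>_. euclidean) {1..n}"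

text \<open>
  A function on an open subset of \<open>\<complex>\<^sup>n\<close> is holomorphic if it is continuous and holomorphic in each
  variable separately.
\<close>

definition holomorphic_fun ::
    "nat \<Rightarrow> (nat \<Rightarrow> complex) set \<Rightarrow> ((nat \<Rightarrow> complex) \<Rightarrow> complex) \<Rightarrow> bool" where
  "holomorphic_fun n U f \<longleftrightarrow>
     continuous_map (subtopology (Cn n) U) euclidean f \<and>
     (\<forall>a\<in>U. \<forall>i\<in>{1..n}. (\<lambda>t. f (a(i := t))) field_differentiable at (a i))"

definition biholomorphic ::
    "nat \<Rightarrow> (nat \<Rightarrow> complex) set \<Rightarrow> (nat \<Rightarrow> complex) set \<Rightarrow>
     ((nat \<Rightarrow> complex) \<Rightarrow> nat \<Rightarrow> complex) \<Rightarrow> bool" where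
  "biholomorphic n U W \<psi> \<longleftrightarrow>
     openin (Cn n) U \<and> openin (Cn n) W \<and> bij_betw \<psi> U W \<and>
     (\<forall>i\<in>{1..n}. holomorphic_fun n U (\<lambda>v. \<psi> v i)) \<and>
     (\<forall>i\<in>{1..n}. holomorphic_fun n W (\<lambda>w. inv_into U \<psi> w i))"

text \<open>
  The subset \<open>Y\<close> of \<open>X\<^sup>n\<close> is a complex submanifold of codimension \<open>k\<close>: near each of its points, in
  the local coordinates of \<open>X\<^sup>n\<close> given by products of local parametrisations of \<open>X\<close>, a biholomorphic
  change of coordinates \<open>\<psi>\<close> turns \<open>Y\<close> into the vanishing locus of the first \<open>k\<close> coordinates.
\<close>

definition has_codim ::
    "('a, 'm) curve_group_scheme \<Rightarrow> nat \<Rightarrow> (nat \<Rightarrow> 'a) set \<Rightarrow> nat \<Rightarrow> bool" where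
  "has_codim X n Y k \<longleftrightarrow>
     k \<le> n \<and> Y \<subseteq> cartesian_power X n \<and>
     (\<forall>V \<phi> a. (\<forall>i\<in>{1..n}. (V i, \<phi> i) \<in> params X) \<and> a \<in> ({1..n} \<rightarrow>\<^sub>E UNIV) \<and>
        (\<forall>i\<in>{1..n}. a i \<in> V i) \<and> (\<lambda>i\<in>{1..n}. \<phi> i (a i)) \<in> Y \<longrightarrow>
        (\<exists>U W \<psi>. a \<in> U \<and> U \<subseteq> (\<Pi>\<^sub>E i\<in>{1..n}. V i) \<and> biholomorphic n U W \<psi> \<and>
           (\<forall>v\<in>U. (\<lambda>i\<in>{1..n}. \<phi> i (v i)) \<in> Y \<longleftrightarrow> (\<forall>i\<in>{1..k}. \<psi> v i = 0))))"


section \<open>Labelled partitions\<close>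

text \<open>
  The set \<open>\<^bold>n = {1, \<bar>1, \<dots>, n, \<bar>n}\<close> is encoded by the nonzero integers of absolute value at most \<open>n\<close>,
  the bar being negation.
\<close>

definition signed_set :: "nat \<Rightarrow> int set" where
  "signed_set n = {k. k \<noteq> 0 \<and> \<bar>k\<bar> \<le> int n}"

abbreviation bar_set :: "int set \<Rightarrow> int set" where
  "bar_set S \<equiv> uminus ` S"

text \<open>The labelling \<open>f : T \<rightarrow> L\<close> is a partial function with domain \<open>T\<close>.\<close>

type_synonym 'l lpartition = "int set set \<times> (int set \<rightharpoonup> 'l)"

definition labelled_partition_on :: "int set \<Rightarrow> 'l set \<Rightarrow> 'l lpartition \<Rightarrow> bool" where
  "labelled_partition_on A L = (\<lambda>(\<Sigma>, f).
     partition_on A \<Sigma> \<and> dom f \<subseteq> \<Sigma> \<and> ran f \<subseteq> L \<and> inj_on f (dom f))"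

text \<open>\<open>\<Sigma>\<^sub>z\<close>: the union is over at most one part, as labellings are injective.\<close>

definition part_of_label :: "'l lpartition \<Rightarrow> 'l \<Rightarrow> int set" where
  "part_of_label = (\<lambda>(\<Sigma>, f) z. \<Union>{S \<in> \<Sigma>. f S = Some z})"

definition symmetric_partitions :: "('a, 'm) monoid_scheme \<Rightarrow> nat \<Rightarrow> 'a lpartition set" where
  "symmetric_partitions X n = {(\<Sigma>, f).
     labelled_partition_on (signed_set n) (two_torsion X) (\<Sigma>, f) \<and>
     (\<forall>S\<in>\<Sigma>. bar_set S \<in> \<Sigma>) \<and>
     (\<forall>S\<in>\<Sigma>. S = bar_set S \<longleftrightarrow> S \<in> dom f)}"

fun label_partitions :: "('a, 'm) monoid_scheme \<Rightarrow> root_type \<Rightarrow> nat \<Rightarrow> 'a lpartition set" where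
  "label_partitions X TypeC n = symmetric_partitions X n"
| "label_partitions X TypeB n = {P \<in> symmetric_partitions X n.
     \<forall>z\<in>two_torsion X. card (part_of_label P z) = 2 \<longrightarrow> z = \<one>\<^bsub>X\<^esub>}"
| "label_partitions X TypeD n = {P \<in> symmetric_partitions X n.
     \<forall>z\<in>two_torsion X. card (part_of_label P z) \<noteq> 2}"

definition partition_le ::
    "('a, 'm) monoid_scheme \<Rightarrow> nat \<Rightarrow> 'a lpartition \<Rightarrow> 'a lpartition \<Rightarrow> bool" where
  "partition_le X n P Q \<longleftrightarrow>
     refines (signed_set n) (fst P) (fst Q) \<and>
     (\<forall>z\<in>two_torsion X. part_of_label P z \<subseteq> part_of_label Q z)"

definition partition_rank :: "nat \<Rightarrow> 'l lpartition \<Rightarrow> real" where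
  "partition_rank n = (\<lambda>(\<Sigma>, f). real n - real (card (\<Sigma> - dom f)) / 2)"


section \<open>The hyperoctahedral group and its actions\<close>

type_synonym signed_perm = "(nat \<Rightarrow> nat) \<times> (nat \<Rightarrow> int)"

definition hyperoctahedral :: "nat \<Rightarrow> signed_perm set" where
  "hyperoctahedral n = {(\<sigma>, \<epsilon>). \<sigma> permutes {1..n} \<and> \<epsilon> \<in> {1..n} \<rightarrow>\<^sub>E {1, -1}}"

text \<open>The \<open>\<sigma> i\<close>-th coordinate of \<open>w \<cdot> x\<close> is \<open>x\<^sub>i\<close> to the power \<open>\<epsilon>\<^sub>i\<close>.\<close>

definition act_point ::
    "('a, 'm) monoid_scheme \<Rightarrow> nat \<Rightarrow> signed_perm \<Rightarrow> (nat \<Rightarrow> 'a) \<Rightarrow> nat \<Rightarrow> 'a" where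
  "act_point X n = (\<lambda>(\<sigma>, \<epsilon>) x. \<lambda>j\<in>{1..n}.
     let i = inv_into {1..n} \<sigma> j in x i [^]\<^bsub>X\<^esub> \<epsilon> i)"

definition act_signed :: "signed_perm \<Rightarrow> int \<Rightarrow> int" where
  "act_signed = (\<lambda>(\<sigma>, \<epsilon>) k. sgn k * \<epsilon> (nat \<bar>k\<bar>) * int (\<sigma> (nat \<bar>k\<bar>)))"

text \<open>The part \<open>w \<cdot> S\<close> of \<open>w \<cdot> \<Sigma>\<close> carries the label of \<open>S\<close>, i.e. \<open>(w \<cdot> \<Sigma>)\<^sub>z = w \<cdot> \<Sigma>\<^sub>z\<close>.\<close>

definition act_partition :: "nat \<Rightarrow> signed_perm \<Rightarrow> 'l lpartition \<Rightarrow> 'l lpartition" where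
  "act_partition n w = (\<lambda>(\<Sigma>, f).
     let \<Sigma>' = (\<lambda>S. act_signed w ` S) ` \<Sigma>
     in (\<Sigma>', (\<lambda>S'. f {k \<in> signed_set n. act_signed w k \<in> S'}) |` \<Sigma>'))"


section \<open>Equivariant isomorphisms of ranked posets\<close>

definition ranked_poset_iso ::
    "('a, 'm) curve_group_scheme \<Rightarrow> root_type \<Rightarrow> nat \<Rightarrow>
     ('a lpartition \<Rightarrow> (nat \<Rightarrow> 'a) set) \<Rightarrow> bool" where
  "ranked_poset_iso X R n F \<longleftrightarrow>
     bij_betw F (label_partitions X R n) (layers X R n) \<and>
     (\<forall>P\<in>label_partitions X R n. \<forall>Q\<in>label_partitions X R n.
        partition_le X n P Q \<longleftrightarrow> layer_le (F P) (F Q)) \<and>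
     (\<forall>P\<in>label_partitions X R n. \<forall>k.
        has_codim X n (F P) k \<longleftrightarrow> real k = partition_rank n P)"

definition hyperoctahedral_equivariant ::
    "('a, 'm) curve_group_scheme \<Rightarrow> root_type \<Rightarrow> nat \<Rightarrow>
     ('a lpartition \<Rightarrow> (nat \<Rightarrow> 'a) set) \<Rightarrow> bool" where
  "hyperoctahedral_equivariant X R n F \<longleftrightarrow>
     (\<forall>w\<in>hyperoctahedral n. \<forall>P\<in>label_partitions X R n.
        act_partition n w P \<in> label_partitions X R n \<and>
        F (act_partition n w P) = act_point X n w ` F P)"

end

theory Submission
  imports Defs "HOL-Homology.Invariance_of_Domain"
begin

text \<open>
  Extend a point \<open>x\<close> of \<open>X\<^sup>n\<close> to signed indices by \<open>x\<^sub>-\<^sub>k = x\<^sub>k\<inverse>\<close>.  The isomorphism sends \<open>\<Sigma>\<close> to the set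
  of points that are constant on the parts of \<open>\<Sigma>\<close> and equal to \<open>z\<close> on \<open>\<Sigma>\<^sub>z\<close>.  Choosing in each pair
  \<open>S, \<bar>S\<close> of unlabelled parts the index of least absolute value gives a retraction of \<open>X\<^sup>n\<close> onto this
  set, so it is connected, contains generic points (which recover \<open>\<Sigma>\<close>, hence order and
  injectivity), and is locally a graph over the chosen coordinates (hence the codimension).

  For an intersection \<open>Y\<close> of members of the arrangement, put \<open>k \<sim> l\<close> if the coordinates \<open>k\<close> and \<open>l\<close>
  agree on \<open>Y\<close>.  The coordinates with \<open>k \<sim> -k\<close> take values in the finite set of two-torsion points,
  and the fibres of the resulting locally constant map are sets of the above form; so they
  are the components of \<open>Y\<close>.
\<close>

section \<open>Signed coordinates and labelled partitions\<close>

text \<open>An intersection of hypersurfaces may be disconnected: x_i = x_j and x_i = x_j^-1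
  together force x_i to be a two-torsion point without saying which one. A label records that
  choice. This also explains the special treatment of parts of size 2. A part {k, -k} with label z
  imposes x_k = z and nothing else, which only the member H_k^z can impose; a larger labelled part
  follows from pair equations up to the choice of a component. So the size condition in types B and
  D matches the members H_i^z that the arrangement has.

  The hypersurfaces only compare coordinates, inverses of coordinates and fixed torsion points.
  Hence the locale \<open>curve\<close> asks for inversion to be continuous and holomorphic, for
  connectedness, closed points, finite two-torsion and charts, and the argument runs once for all
  three groups.

  The rank clause is an equivalence: a layer must have the expected codimension and no other.
  Existence is an explicit change of coordinates; uniqueness is a topological fact about
  dimension.\<close>

definition coord :: "('a, 'm) monoid_scheme \<Rightarrow> (nat \<Rightarrow> 'a) \<Rightarrow> int \<Rightarrow> 'a" where
  "coord X x k = (if 0 < k then x (nat k) else inv\<^bsub>X\<^esub> x (nat (- k)))"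

definition layer_of :: "('a, 'm) monoid_scheme \<Rightarrow> nat \<Rightarrow> 'a lpartition \<Rightarrow> (nat \<Rightarrow> 'a) set" where
  "layer_of X n P = {x \<in> cartesian_power X n.
     (\<forall>S\<in>fst P. \<forall>k\<in>S. \<forall>l\<in>S. coord X x k = coord X x l) \<and>
     (\<forall>S z. snd P S = Some z \<longrightarrow> (\<forall>k\<in>S. coord X x k = z))}"

lemma layer_ofI:
  assumes "x \<in> cartesian_power X n"
    and "\<And>S k l. S \<in> fst P \<Longrightarrow> k \<in> S \<Longrightarrow> l \<in> S \<Longrightarrow> coord X x k = coord X x l"
    and "\<And>S z k. snd P S = Some z \<Longrightarrow> k \<in> S \<Longrightarrow> coord X x k = z"
  shows "x \<in> layer_of X n P"
  unfolding layer_of_def using assms by blast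

lemma layer_ofD:
  assumes "x \<in> layer_of X n P"
  shows "x \<in> cartesian_power X n"
    and "S \<in> fst P \<Longrightarrow> k \<in> S \<Longrightarrow> l \<in> S \<Longrightarrow> coord X x k = coord X x l"
    and "snd P S = Some z \<Longrightarrow> k \<in> S \<Longrightarrow> coord X x k = z"
  using assms unfolding layer_of_def by blast+

lemma signed_set_iff: "k \<in> signed_set n \<longleftrightarrow> nat \<bar>k\<bar> \<in> {1..n}"
  by (auto simp: signed_set_def)

lemma finite_signed_set: "finite (signed_set n)"
proof -
  have "signed_set n \<subseteq> {- int n..int n}"
    by (auto simp: signed_set_def)
  then show ?thesis
    using finite_subset by blast
qed

lemma uminus_signed_set: "- k \<in> signed_set n \<longleftrightarrow> k \<in> signed_set n"
  by (simp add: signed_set_def)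

lemma int_in_signed_set: "int i \<in> signed_set n \<longleftrightarrow> i \<in> {1..n}"
  by (auto simp: signed_set_def)

context group
begin

lemma two_torsionD:
  assumes "z \<in> two_torsion G"
  shows "z \<in> carrier G" "inv z = z"
  using assms by (auto simp: two_torsion_def)

lemma two_torsionI:
  assumes "z \<in> carrier G" "inv z = z"
  shows "z \<in> two_torsion G"
  using assms by (auto simp: two_torsion_def)

lemma one_in_two_torsion: "\<one> \<in> two_torsion G"
  by (simp add: two_torsion_def)

lemma cartesian_power_closed:
  assumes "x \<in> cartesian_power G n" "i \<in> {1..n}"
  shows "x i \<in> carrier G"
  using assms by (auto simp: cartesian_power_def)

lemma coord_closed:
  assumes "x \<in> cartesian_power G n" "k \<in> signed_set n"
  shows "coord G x k \<in> carrier G"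
  using cartesian_power_closed[OF assms(1), of "nat \<bar>k\<bar>"] assms(2)
  by (auto simp: coord_def signed_set_iff split: if_splits)

lemma coord_uminus:
  assumes "x \<in> cartesian_power G n" "k \<in> signed_set n"
  shows "coord G x (- k) = inv (coord G x k)"
  using cartesian_power_closed[OF assms(1), of "nat \<bar>k\<bar>"] assms(2)
  by (auto simp: coord_def signed_set_iff split: if_splits)

lemma coord_int: "0 < i \<Longrightarrow> coord G x (int i) = x i"
  by (simp add: coord_def)

lemma coord_minus_int: "coord G x (- int i) = inv (x i)"
  by (simp add: coord_def)

lemma cartesian_power_eqI:
  assumes "x \<in> cartesian_power G n" "y \<in> cartesian_power G n"
    and "\<And>k. k \<in> signed_set n \<Longrightarrow> coord G x k = coord G y k"
  shows "x = y"
proof (rule PiE_ext)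
  show "x \<in> {1..n} \<rightarrow>\<^sub>E carrier G" "y \<in> {1..n} \<rightarrow>\<^sub>E carrier G"
    using assms(1,2) by (auto simp: cartesian_power_def)
  show "x i = y i" if "i \<in> {1..n}" for i
    using assms(3)[of "int i"] that by (simp add: coord_int int_in_signed_set)
qed

text \<open>With signed coordinates, x_i = x_j^-1 becomes an equality of the coordinates i and -j,
  so both kinds of pair hypersurface become one. The condition on absolute values excludes k = l and
  also l = -k, whose equation says that a single coordinate is two-torsion.\<close>

lemma pair_part_eq:
  "pair_part G n = {{x \<in> cartesian_power G n. coord G x k = coord G x l} |k l.
     k \<in> signed_set n \<and> l \<in> signed_set n \<and> \<bar>k\<bar> \<noteq> \<bar>l\<bar>}" (is "_ = ?R")
proof
  have "H_eq G n i j \<in> ?R" "H_inv G n i j \<in> ?R" if "1 \<le> i" "i < j" "j \<le> n" for i j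
  proof -
    have "H_eq G n i j = {x \<in> cartesian_power G n. coord G x (int i) = coord G x (int j)}"
      "H_inv G n i j = {x \<in> cartesian_power G n. coord G x (int i) = coord G x (- int j)}"
      using that by (auto simp: H_eq_def H_inv_def coord_int coord_minus_int)
    moreover have "int i \<in> signed_set n" "int j \<in> signed_set n" "- int j \<in> signed_set n"
      "\<bar>int i\<bar> \<noteq> \<bar>int j\<bar>" "\<bar>int i\<bar> \<noteq> \<bar>- int j\<bar>"
      using that by (auto simp: signed_set_def)
    ultimately show "H_eq G n i j \<in> ?R" "H_inv G n i j \<in> ?R"
      by blast+
  qed
  then show "pair_part G n \<subseteq> ?R"
    unfolding pair_part_def by blast
next
  show "?R \<subseteq> pair_part G n"
  proof safe
    fix k l assume k: "k \<in> signed_set n" and l: "l \<in> signed_set n" and kl: "\<bar>k\<bar> \<noteq> \<bar>l\<bar>"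
    define E where "E k l = {x \<in> cartesian_power G n. coord G x k = coord G x l}" for k l
    have less: "E k l \<in> pair_part G n"
      if k: "k \<in> signed_set n" and l: "l \<in> signed_set n" and kl: "\<bar>k\<bar> < \<bar>l\<bar>" for k l
    proof -
      let ?i = "nat \<bar>k\<bar>" and ?j = "nat \<bar>l\<bar>"
      have ij: "1 \<le> ?i" "?i < ?j" "?j \<le> n"
        using that by (auto simp: signed_set_def)
      have "E k l = (if (0 < k) = (0 < l) then H_eq G n ?i ?j else H_inv G n ?i ?j)"
      proof -
        have "coord G x k = coord G x l \<longleftrightarrow>
            (if (0 < k) = (0 < l) then x ?i = x ?j else x ?i = inv (x ?j))"
          if "x \<in> cartesian_power G n" for x
        proof -
          have carr: "x ?i \<in> carrier G" "x ?j \<in> carrier G"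
            using cartesian_power_closed[OF that] ij by auto
          then have "inv x ?i = inv x ?j \<longleftrightarrow> x ?i = x ?j" "inv x ?i = x ?j \<longleftrightarrow> x ?i = inv x ?j"
            by (metis inv_inv)+
          then show ?thesis
            using k l carr
            by (auto simp: coord_def signed_set_def)
        qed
        then show ?thesis
          by (auto simp: E_def H_eq_def H_inv_def)
      qed
      moreover have "H_eq G n ?i ?j \<in> pair_part G n" "H_inv G n ?i ?j \<in> pair_part G n"
        using ij unfolding pair_part_def by blast+
      ultimately show ?thesis
        by simp
    qed
    have "E k l = E l k"
      by (auto simp: E_def)
    then have "E k l \<in> pair_part G n"
      using less[OF k l] less[OF l k] kl by (cases "\<bar>k\<bar> < \<bar>l\<bar>") simp_all
    then show "{x \<in> cartesian_power G n. coord G x k = coord G x l} \<in> pair_part G n"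
      by (simp add: E_def)
  qed
qed

text \<open>This one predicate governs both sides: it selects the members H_i^z of the arrangement,
  and the labels that a part of size 2 may carry. With it the three types are treated
  uniformly.\<close>

definition point_label :: "root_type \<Rightarrow> 'a \<Rightarrow> bool" where
  "point_label R z \<longleftrightarrow> z \<in> two_torsion G \<and> (R = TypeC \<or> R = TypeB \<and> z = \<one>)"

lemma arrangement_eq:
  "arrangement G R n =
     {{x \<in> cartesian_power G n. coord G x k = coord G x l} |k l.
       k \<in> signed_set n \<and> l \<in> signed_set n \<and> \<bar>k\<bar> \<noteq> \<bar>l\<bar>} \<union>
     {H_pt G n i z |i z. i \<in> {1..n} \<and> point_label R z}"
proof -
  have "{H_pt G n i z |i z. i \<in> {1..n} \<and> point_label R z} =
      (case R of TypeB \<Rightarrow> {H_pt G n i \<one> |i. i \<in> {1..n}}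
       | TypeC \<Rightarrow> {H_pt G n i z |i z. i \<in> {1..n} \<and> z \<in> two_torsion G}
       | TypeD \<Rightarrow> {})"
    using one_in_two_torsion by (cases R) (simp_all add: point_label_def)
  then show ?thesis
    unfolding pair_part_eq[symmetric] by (cases R) (simp_all only: arrangement.simps root_type.case Un_empty_right)
qed

lemma label_partitions_eq:
  "label_partitions G R n = {P \<in> symmetric_partitions G n.
     \<forall>z\<in>two_torsion G. card (part_of_label P z) = 2 \<longrightarrow> point_label R z}"
  by (cases R) (auto simp: point_label_def)

end

section \<open>Labelled partitions and antisymmetry of their order\<close>

lemma symmetric_partitionsI:
  assumes "partition_on (signed_set n) (fst P)" "dom (snd P) \<subseteq> fst P"
    "ran (snd P) \<subseteq> two_torsion X" "inj_on (snd P) (dom (snd P))"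
    "\<And>S. S \<in> fst P \<Longrightarrow> bar_set S \<in> fst P \<and> (S = bar_set S \<longleftrightarrow> S \<in> dom (snd P))"
  shows "P \<in> symmetric_partitions X n"
  using assms by (cases P) (simp add: symmetric_partitions_def labelled_partition_on_def)

lemma symmetric_partitionsD:
  assumes "P \<in> symmetric_partitions X n"
  shows "partition_on (signed_set n) (fst P)" "dom (snd P) \<subseteq> fst P"
    "ran (snd P) \<subseteq> two_torsion X" "inj_on (snd P) (dom (snd P))"
    "S \<in> fst P \<Longrightarrow> bar_set S \<in> fst P"
    "S \<in> fst P \<Longrightarrow> S = bar_set S \<longleftrightarrow> S \<in> dom (snd P)"
proof -
  obtain \<Sigma> f where "P = (\<Sigma>, f)"
    by (cases P)
  then show "partition_on (signed_set n) (fst P)" "dom (snd P) \<subseteq> fst P"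
    "ran (snd P) \<subseteq> two_torsion X" "inj_on (snd P) (dom (snd P))"
    "S \<in> fst P \<Longrightarrow> bar_set S \<in> fst P"
    "S \<in> fst P \<Longrightarrow> S = bar_set S \<longleftrightarrow> S \<in> dom (snd P)"
    using assms unfolding symmetric_partitions_def labelled_partition_on_def by simp_all
qed

lemma part_of_label_eq:
  assumes "P \<in> symmetric_partitions X n" "snd P S = Some z"
  shows "part_of_label P z = S"
proof -
  note P = symmetric_partitionsD[OF assms(1)]
  have "T = S" if "snd P T = Some z" for T
    using inj_onD[OF P(4), of T S] that assms(2) by auto
  moreover have "S \<in> fst P"
    using P(2) assms(2) by blast
  ultimately have "{T \<in> fst P. snd P T = Some z} = {S}"
    using assms(2) by blast
  then show ?thesis
    by (simp add: part_of_label_def split_beta)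
qed

lemma in_part_of_label:
  assumes "P \<in> symmetric_partitions X n"
  shows "k \<in> part_of_label P z \<longleftrightarrow> (\<exists>S. snd P S = Some z \<and> k \<in> S)"
  using symmetric_partitionsD(2)[OF assms] by (auto simp: part_of_label_def split_beta)

text \<open>The order sees a labelling only through the sets \<Sigma>_z. Since parts are nonempty
  and labellings injective, these sets determine which part carries which label.\<close>

lemma partition_le_antisym:
  assumes P: "P \<in> symmetric_partitions X n" and Q: "Q \<in> symmetric_partitions X n"
    and le: "partition_le X n P Q" "partition_le X n Q P"
  shows "P = Q"
proof -
  have fst: "fst P = fst Q"
    using le refines_asym by (auto simp: partition_le_def)
  have label: "part_of_label P z = part_of_label Q z" if "z \<in> two_torsion X" for z
    using le that by (auto simp: partition_le_def)
  have sub: "snd Q S = Some z"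
    if P: "P \<in> symmetric_partitions X n" and Q: "Q \<in> symmetric_partitions X n"
      and fst: "fst P = fst Q" and S: "snd P S = Some z"
      and label: "\<And>z. z \<in> two_torsion X \<Longrightarrow> part_of_label P z = part_of_label Q z" for P Q S z
  proof -
    have "z \<in> two_torsion X"
      using symmetric_partitionsD(3)[OF P] S by (meson ranI subsetD)
    then have SQ: "part_of_label Q z = S"
      using label part_of_label_eq[OF P S] by simp
    have "S \<in> fst P"
      using symmetric_partitionsD(2)[OF P] S by blast
    then obtain k where "k \<in> S"
      using partition_onD3[OF symmetric_partitionsD(1)[OF P]] by (metis ex_in_conv)
    then obtain T where "snd Q T = Some z"
      using SQ in_part_of_label[OF Q] by metis
    then show ?thesis
      using part_of_label_eq[OF Q] SQ by metis
  qed
  have "snd P S = snd Q S" for S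
  proof (cases "snd P S")
    case None
    then show ?thesis
      using sub[OF Q P fst[symmetric] _ label[symmetric]] by (cases "snd Q S") auto
  next
    case (Some z)
    then show ?thesis
      using sub[OF P Q fst _ label] by metis
  qed
  then show ?thesis
    using fst by (simp add: prod_eq_iff ext)
qed

section \<open>The action of the hyperoctahedral group\<close>

locale signed_permutation =
  fixes n :: nat and \<sigma> :: "nat \<Rightarrow> nat" and \<epsilon> :: "nat \<Rightarrow> int"
  assumes hyperoctahedral: "(\<sigma>, \<epsilon>) \<in> hyperoctahedral n"
begin

abbreviation "act \<equiv> act_signed (\<sigma>, \<epsilon>)"

lemma permutes: "\<sigma> permutes {1..n}"
  using hyperoctahedral by (simp add: hyperoctahedral_def)

lemma sign: "i \<in> {1..n} \<Longrightarrow> \<epsilon> i = 1 \<or> \<epsilon> i = - 1"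
  using hyperoctahedral by (auto simp: hyperoctahedral_def)

lemma act_uminus: "act (- k) = - act k"
  by (simp add: act_signed_def)

lemma act_int: "i \<in> {1..n} \<Longrightarrow> act (int i) = \<epsilon> i * int (\<sigma> i)"
  by (simp add: act_signed_def)

lemma abs_act:
  assumes "k \<in> signed_set n"
  shows "nat \<bar>act k\<bar> = \<sigma> (nat \<bar>k\<bar>)"
proof -
  have "\<bar>\<epsilon> (nat \<bar>k\<bar>)\<bar> = 1" "\<bar>sgn k\<bar> = 1"
    using sign[of "nat \<bar>k\<bar>"] assms by (auto simp: signed_set_iff abs_sgn_eq)
  then show ?thesis
    by (simp add: act_signed_def abs_mult)
qed

lemma act_in: "k \<in> signed_set n \<Longrightarrow> act k \<in> signed_set n"
  using permutes_in_image[OF permutes] abs_act by (simp add: signed_set_iff)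

lemma act_inj: "inj_on act (signed_set n)"
proof (rule inj_onI)
  fix k l assume k: "k \<in> signed_set n" and l: "l \<in> signed_set n" and eq: "act k = act l"
  have "\<sigma> (nat \<bar>k\<bar>) = \<sigma> (nat \<bar>l\<bar>)"
    using abs_act[OF k] abs_act[OF l] eq by simp
  then have "\<bar>k\<bar> = \<bar>l\<bar>"
    using permutes_inj[OF permutes] by (simp add: inj_eq)
  then have "k = l \<or> k = - l"
    by (simp add: abs_eq_iff)
  moreover have "act l \<noteq> 0"
    using act_in[OF l] by (simp add: signed_set_def)
  ultimately show "k = l"
    using eq act_uminus[of l] by auto
qed

lemma act_surj: "act ` signed_set n = signed_set n"
  using endo_inj_surj[OF finite_signed_set _ act_inj] act_in by blast

lemma act_image_eq_iff:
  "S \<subseteq> signed_set n \<Longrightarrow> T \<subseteq> signed_set n \<Longrightarrow> act ` S = act ` T \<longleftrightarrow> S = T"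
  by (rule inj_on_image_eq_iff[OF act_inj])

lemma act_vimage: "S \<subseteq> signed_set n \<Longrightarrow> {k \<in> signed_set n. act k \<in> act ` S} = S"
  using inj_on_image_mem_iff[OF act_inj] by blast

lemma bar_act: "bar_set (act ` S) = act ` bar_set S"
  by (simp add: image_image act_uminus)

lemma fst_act_partition: "fst (act_partition n (\<sigma>, \<epsilon>) P) = (`) act ` fst P"
  by (simp add: act_partition_def split_beta Let_def)

text \<open>\<open>act_partition\<close> finds the label of a new part by pulling it back to
  \<open>signed_set n\<close>. Injectivity of the action turns this into a description by images,
  which is easier to transport.\<close>

lemma snd_act_partition:
  assumes "P \<in> symmetric_partitions X n"
  shows "snd (act_partition n (\<sigma>, \<epsilon>) P) T = Some z \<longleftrightarrow> (\<exists>S. snd P S = Some z \<and> T = act ` S)"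
proof -
  have sub: "S \<subseteq> signed_set n" if "S \<in> fst P" for S
    using partition_onD1[OF symmetric_partitionsD(1)[OF assms]] that by blast
  have "snd (act_partition n (\<sigma>, \<epsilon>) P) T = Some z \<longleftrightarrow>
      T \<in> (`) act ` fst P \<and> snd P {k \<in> signed_set n. act k \<in> T} = Some z"
    by (simp add: act_partition_def split_beta Let_def restrict_map_def)
  also have "\<dots> \<longleftrightarrow> (\<exists>S\<in>fst P. T = act ` S \<and> snd P S = Some z)"
    using act_vimage[OF sub] by auto
  also have "\<dots> \<longleftrightarrow> (\<exists>S. snd P S = Some z \<and> T = act ` S)"
    using symmetric_partitionsD(2)[OF assms] by blast
  finally show ?thesis .
qed

lemma act_partition_symmetric:
  assumes P: "P \<in> symmetric_partitions X n"
  shows "act_partition n (\<sigma>, \<epsilon>) P \<in> symmetric_partitions X n"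
proof -
  let ?Q = "act_partition n (\<sigma>, \<epsilon>) P"
  note PD = symmetric_partitionsD[OF P]
  have sub: "S \<subseteq> signed_set n" if "S \<in> fst P" for S
    using partition_onD1[OF PD(1)] that by blast
  have dom: "act ` S \<in> dom (snd ?Q) \<longleftrightarrow> S \<in> dom (snd P)" if "S \<in> fst P" for S
  proof -
    have "T = S" if "snd P T = Some z" "act ` S = act ` T" for T z
      using act_image_eq_iff[of S T] sub[OF \<open>S \<in> fst P\<close>] sub[of T] PD(2) that by blast
    then show ?thesis
      unfolding dom_def mem_Collect_eq using snd_act_partition[OF P] by fastforce
  qed
  have "partition_on (signed_set n) (fst ?Q)"
  proof (rule partition_onI)
    show "\<Union>(fst ?Q) = signed_set n"
      unfolding fst_act_partition image_Union[symmetric] partition_onD1[OF PD(1), symmetric]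
      by (rule act_surj)
    show "disjnt S T" if ST': "S \<in> fst ?Q" "T \<in> fst ?Q" and ne: "S \<noteq> T" for S T
    proof -
      obtain S' T' where ST: "S' \<in> fst P" "T' \<in> fst P" "S = act ` S'" "T = act ` T'"
        using ST' by (auto simp: fst_act_partition)
      then have "S' \<inter> T' = {}"
        using disjointD[OF partition_onD2[OF PD(1)]] ne by blast
      then show ?thesis
        using inj_on_image_Int[OF act_inj, of S' T'] sub ST by (simp add: disjnt_def)
    qed
    show "{} \<notin> fst ?Q"
      using partition_onD3[OF PD(1)] by (auto simp: fst_act_partition)
  qed
  moreover have "dom (snd ?Q) \<subseteq> fst ?Q"
    using snd_act_partition[OF P] PD(2) by (fastforce simp: fst_act_partition)
  moreover have "ran (snd ?Q) \<subseteq> two_torsion X"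
    using snd_act_partition[OF P] PD(3) by (fastforce simp: ran_def)
  moreover have "inj_on (snd ?Q) (dom (snd ?Q))"
  proof (rule inj_onI)
    fix S T assume "S \<in> dom (snd ?Q)" "snd ?Q S = snd ?Q T"
    then obtain z where "snd ?Q S = Some z" "snd ?Q T = Some z"
      by (metis domD)
    then obtain S' T' where "snd P S' = Some z" "snd P T' = Some z" "S = act ` S'" "T = act ` T'"
      using snd_act_partition[OF P] by metis
    then show "S = T"
      using PD(4) by (metis domI inj_onD)
  qed
  moreover have "bar_set S \<in> fst ?Q \<and> (S = bar_set S \<longleftrightarrow> S \<in> dom (snd ?Q))" if SQ: "S \<in> fst ?Q" for S
  proof -
    obtain S' where S': "S' \<in> fst P" "S = act ` S'"
      using SQ by (auto simp: fst_act_partition)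
    then show ?thesis
      using PD(5)[OF S'(1)] PD(6)[OF S'(1)] dom[OF S'(1)] bar_act[of S']
        act_image_eq_iff[of S' "bar_set S'"] sub by (simp add: fst_act_partition)
  qed
  ultimately show ?thesis
    by (rule symmetric_partitionsI)
qed

lemma part_of_label_act_partition:
  assumes P: "P \<in> symmetric_partitions X n"
  shows "part_of_label (act_partition n (\<sigma>, \<epsilon>) P) z = act ` part_of_label P z"
proof -
  have "part_of_label P z = \<Union>{S. snd P S = Some z}"
    by (auto simp: in_part_of_label[OF P])
  moreover have "part_of_label (act_partition n (\<sigma>, \<epsilon>) P) z = \<Union>((`) act ` {S. snd P S = Some z})"
    by (rule Set.set_eqI)
      (auto simp: in_part_of_label[OF act_partition_symmetric[OF P]] snd_act_partition[OF P])
  ultimately show ?thesis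
    by blast
qed

lemma card_part_of_label_act_partition:
  assumes P: "P \<in> symmetric_partitions X n"
  shows "card (part_of_label (act_partition n (\<sigma>, \<epsilon>) P) z) = card (part_of_label P z)"
proof -
  have "part_of_label P z \<subseteq> signed_set n"
    using in_part_of_label[OF P] symmetric_partitionsD(2)[OF P]
      partition_onD1[OF symmetric_partitionsD(1)[OF P]] by blast
  then show ?thesis
    unfolding part_of_label_act_partition[OF P] using act_inj card_image inj_on_subset by blast
qed

end

context group
begin

lemma act_partition_in_label_partitions:
  assumes w: "w \<in> hyperoctahedral n" and P: "P \<in> label_partitions G R n"
  shows "act_partition n w P \<in> label_partitions G R n"
proof -
  obtain \<sigma> \<epsilon> where w_eq: "w = (\<sigma>, \<epsilon>)"
    by (cases w)
  interpret signed_permutation n \<sigma> \<epsilon>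
    by unfold_locales (use w w_eq in simp)
  have sym: "P \<in> symmetric_partitions G n"
    using P by (simp add: label_partitions_eq)
  show ?thesis
    using P unfolding w_eq label_partitions_eq
    by (simp add: act_partition_symmetric[OF sym] card_part_of_label_act_partition[OF sym])
qed

lemma act_point_apply:
  assumes w: "(\<sigma>, \<epsilon>) \<in> hyperoctahedral n" and x: "x \<in> cartesian_power G n" and i: "i \<in> {1..n}"
  shows "act_point G n (\<sigma>, \<epsilon>) x (\<sigma> i) = (if \<epsilon> i = 1 then x i else inv (x i))"
proof -
  interpret signed_permutation n \<sigma> \<epsilon>
    by unfold_locales (rule w)
  have "inv_into {1..n} \<sigma> (\<sigma> i) = i" "\<sigma> i \<in> {1..n}"
    using i permutes_inj_on[OF permutes] permutes_in_image[OF permutes] by (auto simp: inv_into_f_f)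
  then show ?thesis
    using sign[OF i] cartesian_power_closed[OF x i]
    by (auto simp: act_point_def int_pow_1 int_pow_neg)
qed

lemma act_point_closed:
  assumes w: "(\<sigma>, \<epsilon>) \<in> hyperoctahedral n" and x: "x \<in> cartesian_power G n"
  shows "act_point G n (\<sigma>, \<epsilon>) x \<in> cartesian_power G n"
proof -
  interpret signed_permutation n \<sigma> \<epsilon>
    by unfold_locales (rule w)
  have "act_point G n (\<sigma>, \<epsilon>) x j \<in> carrier G" if j: "j \<in> {1..n}" for j
  proof -
    obtain i where "i \<in> {1..n}" "j = \<sigma> i"
      using permutes_image[OF permutes] j by (metis imageE)
    then show ?thesis
      using act_point_apply[OF w x, of i] cartesian_power_closed[OF x, of i] by simp
  qed
  then show ?thesis
    by (auto simp: cartesian_power_def act_point_def)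
qed

text \<open>Seen on signed indices, the action on points merely moves the value at k to the index w
  k. Hence the equations of a partition turn into those of its image.\<close>

lemma coord_act_point:
  assumes w: "(\<sigma>, \<epsilon>) \<in> hyperoctahedral n" and x: "x \<in> cartesian_power G n" and k: "k \<in> signed_set n"
  shows "coord G (act_point G n (\<sigma>, \<epsilon>) x) (act_signed (\<sigma>, \<epsilon>) k) = coord G x k"
proof -
  interpret signed_permutation n \<sigma> \<epsilon>
    by unfold_locales (rule w)
  let ?y = "act_point G n (\<sigma>, \<epsilon>) x"
  have y: "?y \<in> cartesian_power G n"
    by (rule act_point_closed[OF w x])
  have int: "coord G ?y (act (int i)) = coord G x (int i)" if i: "i \<in> {1..n}" for i
  proof -
    have "\<sigma> i \<in> {1..n}"
      using permutes_in_image[OF permutes] i by blast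
    then show ?thesis
      using sign[OF i] act_point_apply[OF w x i] cartesian_power_closed[OF x i] i
      by (auto simp: act_int[OF i] coord_int coord_minus_int)
  qed
  have i: "nat \<bar>k\<bar> \<in> {1..n}"
    using k by (simp add: signed_set_iff)
  then have i': "int (nat \<bar>k\<bar>) \<in> signed_set n"
    by (simp only: int_in_signed_set)
  consider "k = int (nat \<bar>k\<bar>)" | "k = - int (nat \<bar>k\<bar>)"
    by linarith
  then show ?thesis
  proof cases
    case 1
    then show ?thesis
      using int[OF i] by metis
  next
    case 2
    then show ?thesis
      using int[OF i] act_uminus coord_uminus[OF x i'] coord_uminus[OF y act_in[OF i']] by metis
  qed
qed

lemma layer_of_act_partition:
  assumes w: "w \<in> hyperoctahedral n" and P: "P \<in> symmetric_partitions G n"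
  shows "layer_of G n (act_partition n w P) = act_point G n w ` layer_of G n P"
proof -
  obtain \<sigma> \<epsilon> where w_eq: "w = (\<sigma>, \<epsilon>)"
    by (cases w)
  have w': "(\<sigma>, \<epsilon>) \<in> hyperoctahedral n"
    using w w_eq by simp
  interpret signed_permutation n \<sigma> \<epsilon>
    by unfold_locales (rule w')
  let ?Q = "act_partition n (\<sigma>, \<epsilon>) P"
  have sub: "S \<subseteq> signed_set n" if "S \<in> fst P" for S
    using partition_onD1[OF symmetric_partitionsD(1)[OF P]] that by blast
  have lab_sub: "S \<subseteq> signed_set n" if "snd P S = Some z" for S z
    using symmetric_partitionsD(2)[OF P] sub that by blast
  have iff: "act_point G n (\<sigma>, \<epsilon>) x \<in> layer_of G n ?Q \<longleftrightarrow> x \<in> layer_of G n P"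
    if x: "x \<in> cartesian_power G n" for x
  proof -
    note coord = coord_act_point[OF w' x]
    have "(\<forall>S\<in>fst ?Q. \<forall>k\<in>S. \<forall>l\<in>S. coord G (act_point G n (\<sigma>, \<epsilon>) x) k = coord G (act_point G n (\<sigma>, \<epsilon>) x) l) \<longleftrightarrow>
        (\<forall>S\<in>fst P. \<forall>k\<in>S. \<forall>l\<in>S. coord G x k = coord G x l)"
      unfolding fst_act_partition ball_simps using coord sub
      by (smt (verit, ccfv_threshold) imageE imageI subsetD)
    moreover have "(\<forall>S z. snd ?Q S = Some z \<longrightarrow> (\<forall>k\<in>S. coord G (act_point G n (\<sigma>, \<epsilon>) x) k = z)) \<longleftrightarrow>
        (\<forall>S z. snd P S = Some z \<longrightarrow> (\<forall>k\<in>S. coord G x k = z))"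
      unfolding snd_act_partition[OF P] using coord lab_sub
      by (smt (verit, ccfv_threshold) imageE imageI subsetD)
    ultimately show ?thesis
      using x act_point_closed[OF w' x] by (simp add: layer_of_def)
  qed
  have "\<exists>x\<in>cartesian_power G n. y = act_point G n (\<sigma>, \<epsilon>) x" if y: "y \<in> cartesian_power G n" for y
  proof
    \<comment> \<open>The preimage of \<open>y\<close> is obtained by composing the signed extension
      of \<open>y\<close> with the action on indices, without forming the inverse of the group
      element.\<close>
    let ?x = "\<lambda>i\<in>{1..n}. coord G y (act (int i))"
    have "coord G y (act (int i)) \<in> carrier G" if "i \<in> {1..n}" for i
      using coord_closed[OF y] act_in int_in_signed_set that by blast
    then show x: "?x \<in> cartesian_power G n"
      by (auto simp: cartesian_power_def)
    have int: "coord G ?x (int i) = coord G y (act (int i))" if "i \<in> {1..n}" for i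
      using that by (simp add: coord_int)
    have "coord G ?x k = coord G y (act k)" if k: "k \<in> signed_set n" for k
    proof -
      have i: "nat \<bar>k\<bar> \<in> {1..n}"
        using k by (simp add: signed_set_iff)
      then have i': "int (nat \<bar>k\<bar>) \<in> signed_set n"
        by (simp only: int_in_signed_set)
      consider "k = int (nat \<bar>k\<bar>)" | "k = - int (nat \<bar>k\<bar>)"
        by linarith
      then show ?thesis
        using int[OF i] act_uminus coord_uminus[OF x i'] coord_uminus[OF y act_in[OF i']] by metis
    qed
    then have eq: "coord G y (act k) = coord G (act_point G n (\<sigma>, \<epsilon>) ?x) (act k)" if "k \<in> signed_set n" for k
      using coord_act_point[OF w' x that] that by metis
    show "y = act_point G n (\<sigma>, \<epsilon>) ?x"
    proof (rule cartesian_power_eqI[OF y act_point_closed[OF w' x]])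
      fix k assume "k \<in> signed_set n"
      then obtain j where "j \<in> signed_set n" "k = act j"
        using act_surj by blast
      then show "coord G y k = coord G (act_point G n (\<sigma>, \<epsilon>) ?x) k"
        using eq by simp
    qed
  qed
  then show ?thesis
    unfolding w_eq using iff layer_ofD(1)[of _ G n] by blast
qed

end

section \<open>One-dimensional groups and the retraction onto a layer\<close>

text \<open>The last assumption treats two facts at once: for \<open>s\<close> the identity it says
  that changes of charts are holomorphic, for \<open>s\<close> the inversion that inversion is
  holomorphic in charts. The map \<tau> is required to take values in the prescribed
  \<open>V'\<close>, so that it can later be compared with a coordinate in that chart.\<close>

locale curve = group X for X :: "('a, 'm) curve_group_scheme" (structure) +
  assumes topspace_curve: "topspace (curve_top X) = carrier X"
    and connected_curve: "connected_space (curve_top X)"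
    and t1_curve: "t1_space (curve_top X)"
    and continuous_inv: "continuous_map (curve_top X) (curve_top X) (\<lambda>x. inv x)"
    and finite_two_torsion: "finite (two_torsion X)"
    and params_open: "(V, \<phi>) \<in> params X \<Longrightarrow> open V"
    and params_inj: "(V, \<phi>) \<in> params X \<Longrightarrow> inj_on \<phi> V"
    and params_closed: "(V, \<phi>) \<in> params X \<Longrightarrow> a \<in> V \<Longrightarrow> \<phi> a \<in> carrier X"
    and params_cover: "p \<in> carrier X \<Longrightarrow> \<exists>V \<phi> a. (V, \<phi>) \<in> params X \<and> a \<in> V \<and> \<phi> a = p"
    and params_transition: "(V, \<phi>) \<in> params X \<Longrightarrow> (V', \<phi>') \<in> params X \<Longrightarrow> a \<in> V \<Longrightarrow> a' \<in> V' \<Longrightarrow>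
      s = (\<lambda>p. p) \<or> s = (\<lambda>p. inv p) \<Longrightarrow> \<phi>' a' = s (\<phi> a) \<Longrightarrow>
      \<exists>U \<tau>. open U \<and> a \<in> U \<and> U \<subseteq> V \<and> \<tau> holomorphic_on U \<and> \<tau> ` U \<subseteq> V' \<and> (\<forall>u\<in>U. \<phi>' (\<tau> u) = s (\<phi> u))"
begin

lemma infinite_carrier: "infinite (carrier X)"
proof
  assume fin: "finite (carrier X)"
  obtain V \<phi> a where V: "(V, \<phi>) \<in> params X" "a \<in> V"
    using params_cover[OF one_closed] by blast
  have "\<phi> ` V \<subseteq> carrier X"
    using params_closed[OF V(1)] by blast
  then have "finite V"
    using fin params_inj[OF V(1)] finite_subset inj_on_finite by blast
  then show False
    using finite_imp_not_open[OF _ params_open[OF V(1)]] V(2) by blast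
qed

text \<open>The pairs {p, inv p} of non-torsion points are finite sets covering an infinite set, so
  there are infinitely many of them. One point from each of countably many pairs gives values
  satisfying no equation of the arrangement.\<close>

lemma ex_generic_sequence:
  "\<exists>g :: nat \<Rightarrow> 'a. (\<forall>i. g i \<in> carrier X - two_torsion X) \<and> (\<forall>i j. i \<noteq> j \<longrightarrow> g i \<noteq> g j \<and> g i \<noteq> inv (g j))"
proof -
  let ?O = "(\<lambda>p. {p, inv p}) ` (carrier X - two_torsion X)"
  have inf: "infinite (carrier X - two_torsion X)"
    using infinite_carrier finite_two_torsion by simp
  have "infinite ?O"
  proof
    assume "finite ?O"
    then have "finite (\<Union>?O)"
      by (rule finite_Union) auto
    moreover have "carrier X - two_torsion X \<subseteq> \<Union>?O"
      by blast
    ultimately show False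
      using inf finite_subset by blast
  qed
  then obtain h :: "nat \<Rightarrow> 'a set" where h: "inj h" "range h \<subseteq> ?O"
    using infinite_countable_subset by blast
  then have "\<exists>p. p \<in> carrier X - two_torsion X \<and> h i = {p, inv p}" for i
    by blast
  then obtain g where g: "\<And>i. g i \<in> carrier X - two_torsion X" "\<And>i. h i = {g i, inv (g i)}"
    by metis
  have "g i \<noteq> g j \<and> g i \<noteq> inv (g j)" if "i \<noteq> j" for i j
  proof -
    have "h i \<noteq> h j"
      using h(1) that by (simp add: inj_eq)
    then show ?thesis
      using g(1)[of j] g(2) by (metis DiffE inv_inv insert_commute)
  qed
  then show ?thesis
    using g(1) by blast
qed

lemma topspace_power_top: "topspace (power_top X n) = cartesian_power X n"
  by (simp add: power_top_def cartesian_power_def topspace_curve)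

lemma continuous_coord:
  assumes "k \<in> signed_set n"
  shows "continuous_map (power_top X n) (curve_top X) (\<lambda>x. coord X x k)"
proof -
  have i: "nat \<bar>k\<bar> \<in> {1..n}"
    using assms by (simp add: signed_set_iff)
  have proj: "continuous_map (power_top X n) (curve_top X) (\<lambda>x. x (nat \<bar>k\<bar>))"
    unfolding power_top_def by (rule continuous_map_product_coordinates[OF i])
  show ?thesis
  proof (cases "0 < k")
    case True
    then show ?thesis
      using proj by (simp add: coord_def)
  next
    case False
    then show ?thesis
      using continuous_map_compose[OF proj continuous_inv]
      by (simp add: coord_def o_def)
  qed
qed

end

section \<open>The retraction attached to a labelled partition\<close>

locale curve_partition = curve X for X :: "('a, 'm) curve_group_scheme" (structure) +
  fixes n :: nat and P :: "'a lpartition"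
  assumes partition: "P \<in> symmetric_partitions X n"
begin

definition block :: "int \<Rightarrow> int set" where
  "block k = (THE S. S \<in> fst P \<and> k \<in> S)"

lemma block_eq:
  assumes "S \<in> fst P" "k \<in> S"
  shows "block k = S"
  unfolding block_def
proof (rule the_equality)
  show "T = S" if "T \<in> fst P \<and> k \<in> T" for T
    using disjointD[OF partition_onD2[OF symmetric_partitionsD(1)[OF partition]]] assms that by blast
qed (use assms in simp)

lemma block_in:
  assumes "k \<in> signed_set n"
  shows "block k \<in> fst P" "k \<in> block k"
proof -
  obtain S where "S \<in> fst P" "k \<in> S"
    using partition_onD1[OF symmetric_partitionsD(1)[OF partition]] assms by blast
  then show "block k \<in> fst P" "k \<in> block k"
    using block_eq by auto
qed

lemma part_subset: "S \<in> fst P \<Longrightarrow> S \<subseteq> signed_set n"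
  using partition_onD1[OF symmetric_partitionsD(1)[OF partition]] by blast

lemma part_nonempty: "S \<in> fst P \<Longrightarrow> S \<noteq> {}"
  using partition_onD3[OF symmetric_partitionsD(1)[OF partition]] by blast

lemma block_uminus:
  assumes "k \<in> signed_set n"
  shows "block (- k) = bar_set (block k)"
  using block_eq[of "bar_set (block k)" "- k"] block_in[OF assms] symmetric_partitionsD(5)[OF partition]
  by simp

lemma label_two_torsion: "snd P S = Some z \<Longrightarrow> z \<in> two_torsion X"
  using symmetric_partitionsD(3)[OF partition] by (meson ranI subsetD)

lemma labelled_part: "snd P S = Some z \<Longrightarrow> S \<in> fst P"
  using symmetric_partitionsD(2)[OF partition] by blast

lemma labelled_uminus:
  assumes "snd P S = Some z" "k \<in> S"
  shows "- k \<in> S"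
  using symmetric_partitionsD(6)[OF partition labelled_part[OF assms(1)]] assms
  by (metis domI imageI)

lemma unlabelled_uminus:
  assumes "S \<in> fst P" "snd P S = None" "k \<in> S"
  shows "- k \<notin> S"
proof
  assume "- k \<in> S"
  then have "block k = block (- k)"
    using block_eq assms by simp
  then have "S = bar_set S"
    using block_uminus[of k] block_eq[OF assms(1,3)] part_subset assms by auto
  then show False
    using symmetric_partitionsD(6)[OF partition assms(1)] assms(2) by blast
qed

lemma unlabelled_block_uminus:
  assumes k: "k \<in> signed_set n" and None: "snd P (block k) = None"
  shows "snd P (block (- k)) = None"
proof -
  have "bar_set (bar_set (block k)) = block k"
    by (simp add: image_image)
  then show ?thesis
    using symmetric_partitionsD(6)[OF partition] block_in[OF k] block_uminus[OF k] None
      symmetric_partitionsD(5)[OF partition]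
    by (metis domIff)
qed

definition rep :: "int \<Rightarrow> int" where
  "rep k = arg_min (\<lambda>l. nat \<bar>l\<bar>) (\<lambda>l. l \<in> block k)"

lemma rep_in: "k \<in> signed_set n \<Longrightarrow> rep k \<in> block k"
  unfolding rep_def using block_in by (intro arg_min_natI)

lemma rep_le: "k \<in> signed_set n \<Longrightarrow> l \<in> block k \<Longrightarrow> \<bar>rep k\<bar> \<le> \<bar>l\<bar>"
  using arg_min_nat_le[of "\<lambda>l. l \<in> block k" l "\<lambda>l. nat \<bar>l\<bar>"] by (simp add: rep_def)

lemma block_rep: "k \<in> signed_set n \<Longrightarrow> block (rep k) = block k"
  using block_eq block_in(1) rep_in by blast

lemma rep_signed: "k \<in> signed_set n \<Longrightarrow> rep k \<in> signed_set n"
  using block_in(1) part_subset rep_in by blast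

lemma rep_cong: "block k = block l \<Longrightarrow> rep k = rep l"
  by (simp add: rep_def)

lemma rep_rep: "k \<in> signed_set n \<Longrightarrow> rep (rep k) = rep k"
  by (rule rep_cong[OF block_rep])

text \<open>An unlabelled part never contains both k and -k, so its element of least absolute value
  is unique, and negation carries it to the one of the barred part. This is why representatives are
  chosen by absolute value: the choice is compatible with the bar.\<close>

lemma rep_uminus:
  assumes k: "k \<in> signed_set n" and None: "snd P (block k) = None"
  shows "rep (- k) = - rep k"
proof -
  have k': "- k \<in> signed_set n"
    using k by (simp add: uminus_signed_set)
  have "rep (- k) \<in> bar_set (block k)" "- rep k \<in> block (- k)"
    using rep_in[OF k'] rep_in[OF k] block_uminus[OF k] by auto
  then have 1: "- rep (- k) \<in> block k" and "\<bar>rep (- k)\<bar> \<le> \<bar>- rep k\<bar>" "\<bar>rep k\<bar> \<le> \<bar>- rep (- k)\<bar>"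
    using rep_le[OF k', of "- rep k"] rep_le[OF k, of "- rep (- k)"] by auto
  then have "\<bar>rep (- k)\<bar> = \<bar>rep k\<bar>"
    by simp
  moreover have "rep (- k) \<noteq> rep k"
    using 1 unlabelled_uminus[OF block_in(1)[OF k] None rep_in[OF k]] by auto
  ultimately show ?thesis
    by linarith
qed

definition retract :: "(nat \<Rightarrow> 'a) \<Rightarrow> nat \<Rightarrow> 'a" where
  "retract x = (\<lambda>i\<in>{1..n}. case snd P (block (int i)) of
     Some z \<Rightarrow> z | None \<Rightarrow> coord X x (rep (int i)))"

lemma retract_closed:
  assumes "x \<in> cartesian_power X n"
  shows "retract x \<in> cartesian_power X n"
proof -
  have "retract x i \<in> carrier X" if "i \<in> {1..n}" for i
    using coord_closed[OF assms rep_signed[of "int i"]] label_two_torsion that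
    by (auto simp: retract_def int_in_signed_set two_torsion_def split: option.split)
  then show ?thesis
    by (auto simp: cartesian_power_def retract_def)
qed

text \<open>The formula defining \<open>retract\<close> on positive indices persists on negative
  ones: for unlabelled parts because representatives change sign with the index, for labelled parts
  because the label is its own inverse.\<close>

lemma coord_retract:
  assumes x: "x \<in> cartesian_power X n" and k: "k \<in> signed_set n"
  shows "coord X (retract x) k = (case snd P (block k) of Some z \<Rightarrow> z | None \<Rightarrow> coord X x (rep k))"
proof (cases "0 < k")
  case True
  then show ?thesis
    using k by (auto simp: coord_def retract_def signed_set_def split: option.split)
next
  case False
  let ?i = "nat (- k)"
  have i: "int ?i = - k" "?i \<in> {1..n}"
    using False k by (auto simp: signed_set_def)
  have eq: "coord X (retract x) k =
      inv (case snd P (block (- k)) of Some z \<Rightarrow> z | None \<Rightarrow> coord X x (rep (- k)))"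
    by (simp only: coord_def retract_def restrict_apply i False if_False if_True)
  show ?thesis
  proof (cases "snd P (block k)")
    case None
    have "snd P (block (- k)) = None"
      by (rule unlabelled_block_uminus[OF k None])
    then show ?thesis
      using eq rep_uminus[OF k None] coord_uminus[OF x rep_signed[OF k]] None
        coord_closed[OF x rep_signed[OF k]] by simp
  next
    case (Some z)
    then have "block (- k) = block k"
      using labelled_uminus block_eq block_in[OF k] by metis
    then show ?thesis
      using eq Some label_two_torsion two_torsionD by simp
  qed
qed

lemma retract_in_layer:
  assumes x: "x \<in> cartesian_power X n"
  shows "retract x \<in> layer_of X n P"
proof (rule layer_ofI[OF retract_closed[OF x]])
  fix S k l assume S: "S \<in> fst P" "k \<in> S" "l \<in> S"
  then have "k \<in> signed_set n" "l \<in> signed_set n" "block k = S" "block l = S"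
    using part_subset block_eq by auto
  then show "coord X (retract x) k = coord X (retract x) l"
    using coord_retract[OF x] rep_cong[of k l] by (simp split: option.split)
next
  fix S z k assume S: "snd P S = Some z" "k \<in> S"
  then have "k \<in> signed_set n" "block k = S"
    using part_subset block_eq labelled_part by blast+
  then show "coord X (retract x) k = z"
    using coord_retract[OF x] S by simp
qed

text \<open>The layer is the fixed locus of the retraction. This replaces the equations between
  signed indices by one equation per coordinate, the form in which the layer appears as a
  graph.\<close>

lemma layer_iff_retract:
  assumes x: "x \<in> cartesian_power X n"
  shows "x \<in> layer_of X n P \<longleftrightarrow> (\<forall>i\<in>{1..n}. x i = retract x i)"
proof
  assume L: "x \<in> layer_of X n P"
  show "\<forall>i\<in>{1..n}. x i = retract x i"
  proof
    fix i assume i: "i \<in> {1..n}"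
    then have k: "int i \<in> signed_set n"
      by (simp add: int_in_signed_set)
    have "coord X x (int i) = retract x i"
      using layer_ofD(2)[OF L block_in(1)[OF k] block_in(2)[OF k] rep_in[OF k]]
        layer_ofD(3)[OF L _ block_in(2)[OF k]] i
      by (auto simp: retract_def split: option.split)
    then show "x i = retract x i"
      using i by (simp add: coord_int)
  qed
next
  assume "\<forall>i\<in>{1..n}. x i = retract x i"
  then have "x = retract x"
    using x retract_closed[OF x] unfolding cartesian_power_def by (intro PiE_ext) auto
  then show "x \<in> layer_of X n P"
    using retract_in_layer[OF x] by simp
qed

lemma layer_eq_retract_image: "layer_of X n P = retract ` cartesian_power X n"
proof
  show "retract ` cartesian_power X n \<subseteq> layer_of X n P"
    using retract_in_layer by blast
  show "layer_of X n P \<subseteq> retract ` cartesian_power X n"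
  proof
    fix x assume L: "x \<in> layer_of X n P"
    have x: "x \<in> cartesian_power X n"
      using layer_ofD(1)[OF L] .
    then have "x = retract x"
      using layer_iff_retract[OF x] L retract_closed[OF x]
      unfolding cartesian_power_def by (intro PiE_ext) auto
    then show "x \<in> retract ` cartesian_power X n"
      using x by blast
  qed
qed

lemma continuous_retract: "continuous_map (power_top X n) (power_top X n) retract"
  unfolding power_top_def[of X n] continuous_map_componentwise
proof (intro conjI ballI)
  show "retract ` topspace (product_topology (\<lambda>_. curve_top X) {1..n}) \<subseteq> extensional {1..n}"
    by (auto simp: retract_def)
next
  fix i assume i: "i \<in> {1..n}"
  then have k: "int i \<in> signed_set n"
    by (simp add: int_in_signed_set)
  show "continuous_map (product_topology (\<lambda>_. curve_top X) {1..n}) (curve_top X) (\<lambda>x. retract x i)"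
  proof (cases "snd P (block (int i))")
    case None
    then show ?thesis
      using continuous_coord[OF rep_signed[OF k]] i by (simp add: retract_def power_top_def)
  next
    case (Some z)
    then show ?thesis
      using label_two_torsion[OF Some] i
      by (simp add: retract_def topspace_curve two_torsion_def)
  qed
qed

lemma connected_layer: "connectedin (power_top X n) (layer_of X n P)"
proof -
  have "connectedin (power_top X n) (cartesian_power X n)"
    unfolding power_top_def cartesian_power_def connectedin_PiE
    using connected_curve topspace_curve by (metis connectedin_topspace)
  then show ?thesis
    unfolding layer_eq_retract_image
    using connectedin_continuous_map_image[OF continuous_retract] by blast
qed

text \<open>Start from a point whose signed coordinates are pairwise distinct and non-torsion.
  Retracting it creates only the coincidences demanded by the partition, and torsion values only on
  labelled parts.\<close>

lemma generic_point:
  obtains x where "x \<in> layer_of X n P"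
    and "\<And>k l. k \<in> signed_set n \<Longrightarrow> l \<in> signed_set n \<Longrightarrow> coord X x k = coord X x l \<Longrightarrow>
           \<exists>S\<in>fst P. k \<in> S \<and> l \<in> S"
    and "\<And>k. k \<in> signed_set n \<Longrightarrow> coord X x k \<in> two_torsion X \<Longrightarrow>
           \<exists>S. snd P S = Some (coord X x k) \<and> k \<in> S"
proof -
  obtain g :: "nat \<Rightarrow> 'a" where g: "\<And>i. g i \<in> carrier X - two_torsion X"
      "\<And>i j. i \<noteq> j \<Longrightarrow> g i \<noteq> g j \<and> g i \<noteq> inv (g j)"
    using ex_generic_sequence by blast
  define y where "y = restrict g {1..n}"
  have y: "y \<in> cartesian_power X n"
    using g(1) by (auto simp: y_def cartesian_power_def)
  have ginv: "g i \<noteq> inv (g j)" for i j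
    using g two_torsionI[of "g i"] by (cases "i = j") (metis DiffE, blast)
  have ginj: "inv (g i) = inv (g j) \<longleftrightarrow> i = j" "g i = g j \<longleftrightarrow> i = j" for i j
    using g by (metis DiffE inv_inv)+
  have y_coord: "coord X y k = (if 0 < k then g (nat k) else inv (g (nat (- k))))"
    if "k \<in> signed_set n" for k
    using that by (auto simp: coord_def y_def signed_set_def)
  have y_inj: "k = l" if "k \<in> signed_set n" "l \<in> signed_set n" "coord X y k = coord X y l" for k l
    using that ginv ginv[symmetric] ginj unfolding y_coord[OF that(1)] y_coord[OF that(2)]
    by (auto simp: signed_set_def split: if_splits)
  have y_tors: "coord X y k \<notin> two_torsion X" if "k \<in> signed_set n" for k
    using g(1) two_torsionD two_torsionI unfolding y_coord[OF that] by (metis DiffE inv_inv)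
  define x where "x = retract y"
  have x: "coord X x k = (case snd P (block k) of Some z \<Rightarrow> z | None \<Rightarrow> coord X y (rep k))"
    if "k \<in> signed_set n" for k
    unfolding x_def by (rule coord_retract[OF y that])
  show thesis
  proof
    show "x \<in> layer_of X n P"
      unfolding x_def by (rule retract_in_layer[OF y])
    show tors: "\<exists>S. snd P S = Some (coord X x k) \<and> k \<in> S"
      if k: "k \<in> signed_set n" and "coord X x k \<in> two_torsion X" for k
      using that(2) x[OF k] y_tors[OF rep_signed[OF k]] block_in(2)[OF k]
      by (cases "snd P (block k)") auto
    show "\<exists>S\<in>fst P. k \<in> S \<and> l \<in> S"
      if k: "k \<in> signed_set n" and l: "l \<in> signed_set n" and eq: "coord X x k = coord X x l" for k l
    proof -
      have "block k = block l"
      proof (cases "snd P (block k)")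
        case (Some z)
        have "coord X x l = z"
          using x[OF k] eq Some by simp
        then have "snd P (block l) = Some z"
          using tors[OF l] label_two_torsion[OF Some] block_eq labelled_part by metis
        then show ?thesis
          using Some symmetric_partitionsD(4)[OF partition] by (metis domI inj_onD)
      next
        case None
        have "snd P (block l) = None"
        proof (rule ccontr)
          assume "snd P (block l) \<noteq> None"
          then obtain z where z: "snd P (block l) = Some z"
            by auto
          then have "coord X x k = z"
            using x[OF l] eq by simp
          then show False
            using x[OF k] None y_tors[OF rep_signed[OF k]] label_two_torsion[OF z] by simp
        qed
        then have "coord X y (rep k) = coord X y (rep l)"
          using x[OF k] x[OF l] None eq by simp
        then have "rep k = rep l"
          using y_inj rep_signed k l by blast
        then show ?thesis
          using block_rep k l by metis
      qed
      then show ?thesis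
        using block_in k l by metis
    qed
  qed
qed

lemma layer_nonempty: "layer_of X n P \<noteq> {}"
  by (rule generic_point) auto

end

section \<open>Comparison of the two orders\<close>

context curve
begin

text \<open>For the converse a single generic point of the layer of \<open>Q\<close> suffices: lying
  in the layer of \<open>P\<close>, it satisfies the equations of \<open>P\<close>, and by
  genericity each of them is already imposed by \<open>Q\<close>.\<close>

lemma partition_le_iff_layer_le:
  assumes P: "P \<in> symmetric_partitions X n" and Q: "Q \<in> symmetric_partitions X n"
  shows "partition_le X n P Q \<longleftrightarrow> layer_le (layer_of X n P) (layer_of X n Q)"
proof
  interpret P: curve_partition X n P
    by unfold_locales (rule P)
  interpret Q: curve_partition X n Q
    by unfold_locales (rule Q)
  {
    assume le: "partition_le X n P Q"
    have "x \<in> layer_of X n P" if x: "x \<in> layer_of X n Q" for x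
    proof (rule layer_ofI[OF layer_ofD(1)[OF x]])
      fix S k l assume S: "S \<in> fst P" "k \<in> S" "l \<in> S"
      then obtain T where "T \<in> fst Q" "S \<subseteq> T"
        using le by (auto simp: partition_le_def refines_def)
      then show "coord X x k = coord X x l"
        using layer_ofD(2)[OF x, of T] S by blast
    next
      fix S z k assume S: "snd P S = Some z" "k \<in> S"
      then have "k \<in> part_of_label P z"
        using in_part_of_label[OF P] by blast
      then have "k \<in> part_of_label Q z"
        using le P.label_two_torsion[OF S(1)] by (auto simp: partition_le_def)
      then show "coord X x k = z"
        using in_part_of_label[OF Q] layer_ofD(3)[OF x] by blast
    qed
    then show "layer_le (layer_of X n P) (layer_of X n Q)"
      by (auto simp: layer_le_def)
  next
    assume le: "layer_le (layer_of X n P) (layer_of X n Q)"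
    obtain x where x: "x \<in> layer_of X n Q"
      and gen: "\<And>k l. k \<in> signed_set n \<Longrightarrow> l \<in> signed_set n \<Longrightarrow> coord X x k = coord X x l \<Longrightarrow>
           \<exists>S\<in>fst Q. k \<in> S \<and> l \<in> S"
      and tors: "\<And>k. k \<in> signed_set n \<Longrightarrow> coord X x k \<in> two_torsion X \<Longrightarrow>
           \<exists>S. snd Q S = Some (coord X x k) \<and> k \<in> S"
      by (rule Q.generic_point) (rule that, assumption+)
    have xP: "x \<in> layer_of X n P"
      using x le by (auto simp: layer_le_def)
    have "\<exists>T\<in>fst Q. S \<subseteq> T" if S: "S \<in> fst P" for S
    proof -
      obtain k where k: "k \<in> S"
        using P.part_nonempty[OF S] by blast
      have "S \<subseteq> Q.block k"
      proof
        fix l assume l: "l \<in> S"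
        then obtain T where "T \<in> fst Q" "k \<in> T" "l \<in> T"
          using gen[of k l] layer_ofD(2)[OF xP S k l] k P.part_subset[OF S] by blast
        then show "l \<in> Q.block k"
          using Q.block_eq by simp
      qed
      then show ?thesis
        using Q.block_in(1)[of k] k P.part_subset[OF S] by blast
    qed
    moreover have "part_of_label P z \<subseteq> part_of_label Q z" if z: "z \<in> two_torsion X" for z
    proof
      fix k assume "k \<in> part_of_label P z"
      then obtain S where S: "snd P S = Some z" "k \<in> S"
        using in_part_of_label[OF P] by blast
      then have "coord X x k = z" "k \<in> signed_set n"
        using layer_ofD(3)[OF xP] P.labelled_part P.part_subset by blast+
      then show "k \<in> part_of_label Q z"
        using tors[of k] z in_part_of_label[OF Q] by blast
    qed
    ultimately show "partition_le X n P Q"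
      using symmetric_partitionsD(1)[OF P] symmetric_partitionsD(1)[OF Q]
      by (auto simp: partition_le_def refines_def)
  }
qed

lemma inj_on_layer_of: "inj_on (layer_of X n) (symmetric_partitions X n)"
proof (rule inj_onI)
  fix P Q assume P: "P \<in> symmetric_partitions X n" and Q: "Q \<in> symmetric_partitions X n"
    and eq: "layer_of X n P = layer_of X n Q"
  have "partition_le X n P Q" "partition_le X n Q P"
    using partition_le_iff_layer_le[OF P Q] partition_le_iff_layer_le[OF Q P] eq
    by (simp_all add: layer_le_def)
  then show "P = Q"
    by (rule partition_le_antisym[OF P Q])
qed

end

section \<open>Components of intersections\<close>

context curve
begin

definition torsion_coord :: "nat \<Rightarrow> (nat \<Rightarrow> 'a) set \<Rightarrow> int \<Rightarrow> bool" where
  "torsion_coord n Y k \<longleftrightarrow> k \<in> signed_set n \<and> (\<forall>y\<in>Y. coord X y (- k) = coord X y k)"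

definition fibre :: "nat \<Rightarrow> (nat \<Rightarrow> 'a) set \<Rightarrow> (nat \<Rightarrow> 'a) \<Rightarrow> (nat \<Rightarrow> 'a) set" where
  "fibre n Y x = {y \<in> Y. \<forall>k. torsion_coord n Y k \<longrightarrow> coord X y k = coord X x k}"

lemma torsion_coord_two_torsion:
  assumes "Y \<subseteq> cartesian_power X n" "torsion_coord n Y k" "y \<in> Y"
  shows "coord X y k \<in> two_torsion X"
  using assms coord_uminus[of y n k] coord_closed[of y n k]
  by (intro two_torsionI) (auto simp: torsion_coord_def)

lemma self_in_fibre: "x \<in> Y \<Longrightarrow> x \<in> fibre n Y x"
  by (simp add: fibre_def)

text \<open>On the fibre through \<open>x\<close> the torsion coordinates are frozen at their values
  at \<open>x\<close>, while the other coordinates are constrained only by the equalities valid on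
  all of \<open>Y\<close>. The partition is read off from these two kinds of constraint; what needs
  an argument is the size condition for types B and D.\<close>

lemma fibre_eq_layer_of:
  assumes S: "S \<subseteq> arrangement X R n" and Y_eq: "Y = cartesian_power X n \<inter> \<Inter>S" and x: "x \<in> Y"
  shows "\<exists>Q\<in>label_partitions X R n. layer_of X n Q = fibre n Y x"
proof -
  have Y: "Y \<subseteq> cartesian_power X n"
    using Y_eq by blast
  let ?A = "signed_set n" and ?T = "torsion_coord n Y"
  define sim where "sim k l \<longleftrightarrow> (\<forall>y\<in>Y. coord X y k = coord X y l)" for k l
  \<comment> \<open>Labels have to be injective, so torsion classes of \<open>sim\<close> on which
    \<open>x\<close> takes the same value are merged into one part, even if their coordinates differ
    elsewhere on \<open>Y\<close>.\<close>
  define E where "E = {(k, l). k \<in> ?A \<and> l \<in> ?A \<and> (sim k l \<or> ?T k \<and> ?T l \<and> coord X x k = coord X x l)}"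
  have T_iff: "?T k \<longleftrightarrow> k \<in> ?A \<and> sim k (- k)" for k
    by (auto simp: torsion_coord_def sim_def)
  have coord_minus: "coord X y (- k) = inv (coord X y k)" if "y \<in> Y" "k \<in> ?A" for y k
    using coord_uminus Y that by blast
  have sim_minus: "sim (- k) (- l)" if "sim k l" "k \<in> ?A" "l \<in> ?A" for k l
    using that coord_minus by (auto simp: sim_def)
  have T_minus: "?T (- k)" if "?T k" for k
    using that by (auto simp: torsion_coord_def uminus_signed_set)
  have T_sim: "?T l" if "?T k" "sim k l" "l \<in> ?A" for k l
    using that sim_minus[of k l] by (auto simp: T_iff sim_def)
  have T_E: "?T l" if "?T k" "(k, l) \<in> E" for k l
    using that T_sim by (auto simp: E_def)
  have E_minus: "(- k, - l) \<in> E" if "(k, l) \<in> E" for k l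
    using that sim_minus T_minus coord_minus[OF x] by (auto simp: E_def uminus_signed_set)
  have x_E: "coord X x k = coord X x l" if "(k, l) \<in> E" for k l
    using that x by (auto simp: E_def sim_def)
  have E_T: "?T k" if "(k, - k) \<in> E" for k
    using that by (auto simp: E_def T_iff)
  have T_E_uminus: "(k, - k) \<in> E" if "?T k" for k
    using that by (auto simp: E_def T_iff uminus_signed_set)
  have equiv: "equiv ?A E"
  proof (rule equivI)
    show "E \<subseteq> ?A \<times> ?A"
      by (auto simp: E_def)
    show "refl_on ?A E"
      by (auto simp: refl_on_def E_def sim_def)
    show "sym E"
      by (auto simp: sym_def E_def sim_def)
    show "trans E"
    proof (rule transI)
      fix k l m assume 1: "(k, l) \<in> E" and 2: "(l, m) \<in> E"
      have sym: "sim b a" if "sim a b" for a b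
        using that by (simp add: sim_def)
      \<comment> \<open>Being torsion is inherited along \<open>E\<close>. If \<open>l\<close> is
        torsion, so are \<open>k\<close> and \<open>m\<close>, and their values at \<open>x\<close>
        agree; otherwise both links come from \<open>sim\<close>, which is transitive.\<close>
      show "(k, m) \<in> E"
      proof (cases "?T l")
        case True
        then have "?T k" "?T m"
          using 1 2 T_sim sym by (auto simp: E_def)
        then show ?thesis
          using x_E[OF 1] x_E[OF 2] 1 2 by (auto simp: E_def)
      next
        case False
        then show ?thesis
          using 1 2 by (auto simp: E_def sim_def)
      qed
    qed
  qed
  \<comment> \<open>The label is the value of \<open>x\<close> on the class; \<open>x\<close> is
    constant on classes of \<open>E\<close>, so the chosen element does not matter. The
    self-conjugate classes turn out to be those consisting of torsion coordinates.\<close>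
  define f where "f B = (if B \<in> ?A // E \<and> B = bar_set B then Some (coord X x (SOME k. k \<in> B)) else None)" for B
  let ?Q = "(?A // E, f)"
  have class_eq: "E `` {k} = B" if "B \<in> ?A // E" "k \<in> B" for B k
    using that equiv by (metis Image_singleton_iff equiv_class_eq quotientE)
  have class_self: "k \<in> E `` {k}" if "k \<in> ?A" for k
    using equiv_class_self[OF equiv that] .
  have class_subset: "B \<subseteq> ?A" if "B \<in> ?A // E" for B
    using that by (auto simp: quotient_def E_def)
  have bar_class: "bar_set (E `` {k}) = E `` {- k}" for k
  proof
    show "bar_set (E `` {k}) \<subseteq> E `` {- k}"
      using E_minus by auto
    show "E `` {- k} \<subseteq> bar_set (E `` {k})"
    proof
      fix l assume "l \<in> E `` {- k}"
      then have "(k, - l) \<in> E"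
        using E_minus[of "- k" l] by simp
      then show "l \<in> bar_set (E `` {k})"
        by (intro image_eqI[of l uminus "- l"]) auto
    qed
  qed
  have bar_in: "bar_set B \<in> ?A // E" if "B \<in> ?A // E" for B
    using that bar_class by (auto elim!: quotientE intro!: quotientI simp: uminus_signed_set)
  have selfconj: "B = bar_set B \<longleftrightarrow> ?T k" if "B \<in> ?A // E" "k \<in> B" for B k
  proof -
    have "B = E `` {k}" "k \<in> ?A"
      using class_eq[OF that] class_subset that by auto
    then show ?thesis
      using bar_class[of k] class_self[of "- k"] E_T[of k] T_E_uminus[of k]
        equiv_class_eq[OF equiv, of k "- k"] by (auto simp: uminus_signed_set)
  qed
  have f_iff: "f B = Some z \<longleftrightarrow> B \<in> ?A // E \<and> (\<exists>k\<in>B. ?T k \<and> coord X x k = z)" for B z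
  proof (cases "B \<in> ?A // E")
    case True
    obtain k where k: "k \<in> B"
      using True equiv in_quotient_imp_non_empty by blast
    then have "(SOME k. k \<in> B) \<in> B"
      by (rule someI)
    moreover have "coord X x k = coord X x l" if "k \<in> B" "l \<in> B" for k l
      using x_E class_eq[OF True that(1)] that by blast
    ultimately show ?thesis
      using True k selfconj[OF True] unfolding f_def by (smt (verit) option.inject option.distinct(1))
  next
    case False
    then show ?thesis
      by (simp add: f_def)
  qed
  have f_const: "coord X x k = z" "?T k" if "f B = Some z" "k \<in> B" for B z k
    using that x_E T_E class_eq[of B] unfolding f_iff by blast+
  have dom_f: "B \<in> dom f \<longleftrightarrow> B = bar_set B" if "B \<in> ?A // E" for B
    using that by (auto simp: f_def dom_def)
  have Q: "?Q \<in> symmetric_partitions X n"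
    unfolding symmetric_partitions_def labelled_partition_on_def
  proof (clarsimp, intro conjI ballI)
    show "partition_on ?A (?A // E)"
      by (rule partition_on_quotient[OF equiv])
    show "dom f \<subseteq> ?A // E"
      by (auto simp: f_def split: if_splits)
    show "ran f \<subseteq> two_torsion X"
      using torsion_coord_two_torsion[OF Y _ x] by (auto simp: ran_def f_iff)
    show "inj_on f (dom f)"
    proof (rule inj_onI)
      fix B C assume "B \<in> dom f" and eq: "f B = f C"
      then obtain z where "f B = Some z" "f C = Some z"
        by (metis domD)
      then obtain k l where B: "B \<in> ?A // E" "k \<in> B" "?T k" "coord X x k = z"
        and C: "C \<in> ?A // E" "l \<in> C" "?T l" "coord X x l = z"
        unfolding f_iff by blast
      then have "(k, l) \<in> E"
        by (auto simp: E_def torsion_coord_def)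
      then show "B = C"
        using equiv_class_eq[OF equiv] class_eq B C by metis
    qed
    show "bar_set B \<in> ?A // E" if "B \<in> ?A // E" for B
      by (rule bar_in[OF that])
    show "B = bar_set B \<longleftrightarrow> B \<in> dom f" if "B \<in> ?A // E" for B
      using dom_f[OF that] by blast
  qed
  \<comment> \<open>If the part labelled z is {k, -k} and no H_i^z is in the arrangement, then no
    member of \<open>S\<close> constrains the coordinate i = |k|: a pair equation involving it would
    put a further index into the part. So i can be given a non-torsion value without leaving
    \<open>Y\<close>, although it is a torsion coordinate.\<close>
  have "point_label R z" if z: "z \<in> two_torsion X" and card: "card (part_of_label ?Q z) = 2" for z
  proof (rule ccontr)
    assume no: "\<not> point_label R z"
    have "part_of_label ?Q z \<noteq> {}"
      using card by auto
    then obtain B k where B: "f B = Some z" "k \<in> B"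
      using in_part_of_label[OF Q] by fastforce
    then have BE: "B \<in> ?A // E" and part: "part_of_label ?Q z = B"
      using part_of_label_eq[OF Q] f_iff by auto
    have Tk: "?T k"
      using f_const[OF B] by blast
    have kA: "k \<in> ?A"
      using Tk by (simp add: torsion_coord_def)
    then have "k \<noteq> - k"
      by (auto simp: signed_set_def)
    moreover have "- k \<in> B"
      using selfconj[OF BE B(2)] Tk B(2) by blast
    moreover have "finite B"
      using class_subset[OF BE] finite_signed_set finite_subset by blast
    ultimately have B_eq: "B = {k, - k}"
      using card_seteq[of B "{k, - k}"] B(2) card part by auto
    define i where "i = nat \<bar>k\<bar>"
    have i: "i \<in> {1..n}"
      using kA by (simp add: i_def signed_set_iff)
    have iB: "int i \<in> B"
      by (auto simp: i_def B_eq abs_if)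
    then have xi: "x i = z" and Ti: "?T (int i)"
      using f_const[OF B(1) iB] i by (auto simp: coord_int)
    obtain g where g: "g \<in> carrier X - two_torsion X"
      using ex_generic_sequence by blast
    define y where "y = x(i := g)"
    have y: "y \<in> cartesian_power X n"
      using x Y g i by (auto simp: y_def cartesian_power_def PiE_def extensional_def Pi_def)
    have y_coord: "coord X y l = coord X x l" if "nat \<bar>l\<bar> \<noteq> i" for l
      using that by (auto simp: coord_def y_def)
    have "y \<in> H" if H: "H \<in> S" for H
    proof -
      have xH: "x \<in> H"
        using x Y_eq H by blast
      consider (pair) k' l' where "k' \<in> ?A" "l' \<in> ?A" "\<bar>k'\<bar> \<noteq> \<bar>l'\<bar>"
          "H = {x \<in> cartesian_power X n. coord X x k' = coord X x l'}"
        | (point) j z' where "j \<in> {1..n}" "point_label R z'" "H = H_pt X n j z'"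
        using H S unfolding arrangement_eq by blast
      then show ?thesis
      proof cases
        case pair
        have "sim k' l'"
          using Y_eq H pair(4) by (auto simp: sim_def)
        then have E: "(k', l') \<in> E" "(l', k') \<in> E"
          using pair by (auto simp: E_def sim_def)
        have "k' \<in> B \<longleftrightarrow> l' \<in> B"
          using class_eq[OF BE, of k'] class_eq[OF BE, of l'] E by blast
        then have "k' \<notin> B" "l' \<notin> B"
          using pair(3) unfolding B_eq by auto
        then have "nat \<bar>k'\<bar> \<noteq> i" "nat \<bar>l'\<bar> \<noteq> i"
          by (auto simp: B_eq i_def)
        then show ?thesis
          using y xH pair(4) y_coord by simp
      next
        case point
        then have "j \<noteq> i"
          using xH xi no by (auto simp: H_pt_def)
        then show ?thesis
          using y xH point by (auto simp: H_pt_def y_def)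
      qed
    qed
    then have "y \<in> Y"
      using y Y_eq by blast
    then have "coord X y (int i) \<in> two_torsion X"
      using torsion_coord_two_torsion[OF Y Ti] by blast
    then show False
      using g i by (simp add: coord_int y_def)
  qed
  then have "?Q \<in> label_partitions X R n"
    using Q by (simp add: label_partitions_eq)
  moreover have "layer_of X n ?Q = fibre n Y x"
  proof (intro equalityI subsetI)
    fix y assume y: "y \<in> fibre n Y x"
    then have yY: "y \<in> Y" and yT: "\<And>k. ?T k \<Longrightarrow> coord X y k = coord X x k"
      by (auto simp: fibre_def)
    show "y \<in> layer_of X n ?Q"
    proof (rule layer_ofI)
      show "y \<in> cartesian_power X n"
        using yY Y by blast
    next
      fix B k l assume "B \<in> fst ?Q" "k \<in> B" "l \<in> B"
      then have "(k, l) \<in> E"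
        using class_eq by fastforce
      then show "coord X y k = coord X y l"
        using yY yT by (auto simp: E_def sim_def)
    next
      fix B z k assume "snd ?Q B = Some z" "k \<in> B"
      then show "coord X y k = z"
        using f_const[of B z k] yT by simp
    qed
  next
    fix y assume L: "y \<in> layer_of X n ?Q"
    have y: "y \<in> cartesian_power X n"
      by (rule layer_ofD(1)[OF L])
    have yE: "coord X y k = coord X y l" if "(k, l) \<in> E" for k l
    proof -
      have "k \<in> ?A"
        using that by (simp add: E_def)
      then show ?thesis
        using layer_ofD(2)[OF L, of "E `` {k}" k l] that class_self quotientI[of k ?A E] by auto
    qed
    have yT: "coord X y k = coord X x k" if "?T k" for k
    proof -
      have k: "k \<in> ?A"
        using that by (simp add: torsion_coord_def)
      have "f (E `` {k}) = Some (coord X x k)"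
        unfolding f_iff using that class_self[OF k] quotientI[OF k, of E] by auto
      then show ?thesis
        using layer_ofD(3)[OF L] class_self[OF k] by simp
    qed
    have "y \<in> H" if H: "H \<in> S" for H
    proof -
      consider (pair) k l where "k \<in> ?A" "l \<in> ?A"
          "H = {x \<in> cartesian_power X n. coord X x k = coord X x l}"
        | (point) j z where "j \<in> {1..n}" "z \<in> two_torsion X" "H = H_pt X n j z"
        using H S unfolding arrangement_eq point_label_def by blast
      then show ?thesis
      proof cases
        case pair
        then have "(k, l) \<in> E"
          using Y_eq H by (auto simp: E_def sim_def)
        then show ?thesis
          using yE y pair by simp
      next
        case point
        have Yj: "v j = z" if "v \<in> Y" for v
          using that Y_eq H point by (auto simp: H_pt_def)
        have "coord X v (- int j) = coord X v (int j)" if "v \<in> Y" for v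
          using Yj[OF that] point(1) two_torsionD(2)[OF point(2)] by (simp add: coord_int coord_minus_int)
        then have "?T (int j)"
          using point(1) by (simp add: torsion_coord_def int_in_signed_set)
        then have "y j = z"
          using yT[of "int j"] point(1) Yj[OF x] by (simp add: coord_int)
        then show ?thesis
          using y point by (simp add: H_pt_def)
      qed
    qed
    then have "y \<in> Y"
      using y Y_eq by blast
    then show "y \<in> fibre n Y x"
      using yT by (simp add: fibre_def)
  qed
  ultimately show ?thesis
    by blast
qed

lemma label_partitions_symmetric: "P \<in> label_partitions X R n \<Longrightarrow> P \<in> symmetric_partitions X n"
  by (simp add: label_partitions_eq)

text \<open>Fibres are closed because points of the curve are closed, and finite in number because
  the torsion coordinates take finitely many values. So the complement of a fibre is a finite union
  of closed sets and the fibre is also open. Being connected and clopen, it is a component.\<close>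

lemma connected_component_eq_fibre:
  assumes S: "S \<subseteq> arrangement X R n" and Y_eq: "Y = cartesian_power X n \<inter> \<Inter>S" and x: "x \<in> Y"
  shows "connected_component_of_set (subtopology (power_top X n) Y) x = fibre n Y x"
proof -
  let ?T = "subtopology (power_top X n) Y"
  have Y: "Y \<subseteq> cartesian_power X n"
    using Y_eq by blast
  have top: "topspace ?T = Y"
    using Y by (simp add: topspace_power_top Int_absorb1)
  have fibre_subset: "fibre n Y y \<subseteq> Y" for y
    by (auto simp: fibre_def)
  have closed: "closedin ?T (fibre n Y y)" if y: "y \<in> Y" for y
  proof -
    have single: "closedin ?T {v \<in> topspace ?T. coord X v k \<in> {coord X y k}}" if "torsion_coord n Y k" for k
    proof (rule closedin_continuous_map_preimage)
      show "continuous_map ?T (curve_top X) (\<lambda>v. coord X v k)"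
        using that continuous_coord[of k n] by (simp add: torsion_coord_def continuous_map_from_subtopology)
      show "closedin (curve_top X) {coord X y k}"
        using closedin_t1_singleton[OF t1_curve] coord_closed[of y n k] y Y that topspace_curve
        by (auto simp: torsion_coord_def)
    qed
    \<comment> \<open>Inserting \<open>Y\<close> covers the case without torsion coordinates, where
      the intersection of the bare family would be the universe.\<close>
    let ?F = "insert Y ((\<lambda>k. {v \<in> Y. coord X v k = coord X y k}) ` {k. torsion_coord n Y k})"
    have "closedin ?T (\<Inter>?F)"
      using single closedin_topspace[of ?T] unfolding top by (intro closedin_Inter) auto
    moreover have "\<Inter>?F = fibre n Y y"
      unfolding fibre_def by blast
    ultimately show ?thesis
      by simp
  qed
  have fin: "finite ((\<lambda>y. fibre n Y y) ` Y)"
  proof -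
    let ?K = "{k. torsion_coord n Y k}"
    have K: "finite ?K"
      using finite_subset[OF _ finite_signed_set[of n], of ?K] by (auto simp: torsion_coord_def)
    let ?r = "\<lambda>y. restrict (coord X y) ?K"
    have "?r ` Y \<subseteq> ?K \<rightarrow>\<^sub>E two_torsion X"
      using torsion_coord_two_torsion[OF Y] by (intro image_subsetI) (simp only: restrict_PiE_iff, simp)
    then have "finite (?r ` Y)"
      by (rule finite_subset) (intro finite_PiE K finite_two_torsion)
    moreover have "fibre n Y y = (\<lambda>r. {v \<in> Y. \<forall>k. torsion_coord n Y k \<longrightarrow> coord X v k = r k}) (?r y)" for y
      by (auto simp: fibre_def)
    then have "(\<lambda>y. fibre n Y y) ` Y = (\<lambda>r. {v \<in> Y. \<forall>k. torsion_coord n Y k \<longrightarrow> coord X v k = r k}) ` (?r ` Y)"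
      by (simp add: image_image)
    ultimately show ?thesis
      by simp
  qed
  have "Y - fibre n Y x = \<Union>((\<lambda>y. fibre n Y y) ` (Y - fibre n Y x))"
  proof (intro equalityI subsetI)
    fix y assume "y \<in> Y - fibre n Y x"
    then show "y \<in> \<Union>((\<lambda>y. fibre n Y y) ` (Y - fibre n Y x))"
      using self_in_fibre[of y Y n] by blast
  next
    fix v assume "v \<in> \<Union>((\<lambda>y. fibre n Y y) ` (Y - fibre n Y x))"
    then show "v \<in> Y - fibre n Y x"
      by (auto simp: fibre_def)
  qed
  moreover have "closedin ?T (\<Union>((\<lambda>y. fibre n Y y) ` (Y - fibre n Y x)))"
  proof (rule closedin_Union)
    show "finite ((\<lambda>y. fibre n Y y) ` (Y - fibre n Y x))"
      using fin by (rule rev_finite_subset) auto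
  qed (use closed in auto)
  ultimately have "closedin ?T (Y - fibre n Y x)"
    by simp
  then have op: "openin ?T (fibre n Y x)"
    unfolding openin_closedin_eq top using fibre_subset[of x] by blast
  obtain Q where Q: "Q \<in> label_partitions X R n" "layer_of X n Q = fibre n Y x"
    using fibre_eq_layer_of[OF S Y_eq x] by blast
  interpret Q: curve_partition X n Q
    by unfold_locales (rule label_partitions_symmetric[OF Q(1)])
  have conn: "connectedin ?T (fibre n Y x)"
    using Q.connected_layer Q(2) fibre_subset by (simp add: connectedin_subtopology)
  let ?C = "connected_component_of_set ?T x"
  have "x \<in> ?C"
    using x top by (simp add: connected_component_of_refl)
  then have "\<not> disjnt ?C (fibre n Y x)"
    using self_in_fibre[OF x, of n] by (auto simp: disjnt_iff)
  then have "?C \<subseteq> fibre n Y x"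
    using connectedin_clopen_cases[OF connectedin_connected_component_of closed[OF x] op] by blast
  moreover have "fibre n Y x \<subseteq> ?C"
    by (rule connected_component_of_maximal[OF conn self_in_fibre[OF x]])
  ultimately show ?thesis
    by blast
qed

text \<open>\<open>S\<close> consists of all members of the arrangement containing the layer, and
  \<open>x\<close> is generic. The crux is that labelled coordinates are torsion on all of
  \<open>Y\<close>. If the part of \<open>k\<close> has an index j other than k and -k, the pair
  equations equate both coordinates k and -k with coordinate j. If the part is {k, -k}, the size
  condition provides the hypersurface H_i^z with i = |k|.\<close>

lemma layer_of_eq_fibre:
  assumes P: "P \<in> label_partitions X R n"
  shows "\<exists>S x. S \<subseteq> arrangement X R n \<and> x \<in> cartesian_power X n \<inter> \<Inter>S \<and>
    layer_of X n P = fibre n (cartesian_power X n \<inter> \<Inter>S) x"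
proof -
  note sym = label_partitions_symmetric[OF P]
  interpret curve_partition X n P
    by unfold_locales (rule sym)
  let ?A = "signed_set n"
  obtain x where x: "x \<in> layer_of X n P"
    and tors: "\<And>k. k \<in> ?A \<Longrightarrow> coord X x k \<in> two_torsion X \<Longrightarrow> \<exists>S. snd P S = Some (coord X x k) \<and> k \<in> S"
    by (rule generic_point) (rule that, assumption+)
  define S where "S = {H \<in> arrangement X R n. layer_of X n P \<subseteq> H}"
  define Y where "Y = cartesian_power X n \<inter> \<Inter>S"
  have Y: "Y \<subseteq> cartesian_power X n"
    by (auto simp: Y_def)
  have PY: "layer_of X n P \<subseteq> Y"
    using layer_ofD(1)[of _ X n P] by (auto simp: Y_def S_def)
  have pair: "coord X y k = coord X y l"
    if "y \<in> Y" "B \<in> fst P" "k \<in> B" "l \<in> B" "\<bar>k\<bar> \<noteq> \<bar>l\<bar>" for y B k l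
  proof -
    let ?H = "{x \<in> cartesian_power X n. coord X x k = coord X x l}"
    have "k \<in> ?A" "l \<in> ?A"
      using part_subset that by blast+
    then have "?H \<in> arrangement X R n"
      unfolding arrangement_eq using that(5) by blast
    moreover have "layer_of X n P \<subseteq> ?H"
      using layer_ofD(1,2)[of _ X n P] that by blast
    ultimately have "?H \<in> S"
      by (simp add: S_def)
    then show ?thesis
      using that(1) by (auto simp: Y_def)
  qed
  have torsion: "torsion_coord n Y k" if B: "snd P B = Some z" "k \<in> B" for B z k
  proof -
    have BP: "B \<in> fst P" and k': "- k \<in> B" and k: "k \<in> ?A"
      using labelled_part[OF B(1)] labelled_uminus[OF B] part_subset B(2) by blast+
    show ?thesis
    proof (cases "B \<subseteq> {k, - k}")
      case True
      then have "B = {k, - k}" "k \<noteq> - k"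
        using B k' k by (auto simp: signed_set_def)
      then have "card (part_of_label P z) = 2"
        using part_of_label_eq[OF sym B(1)] by simp
      then have lab: "point_label R z"
        using P label_two_torsion[OF B(1)] by (simp add: label_partitions_eq)
      let ?i = "nat \<bar>k\<bar>"
      have i: "?i \<in> {1..n}" "int ?i \<in> B"
        using k k' B(2) by (auto simp: signed_set_def abs_if)
      have "H_pt X n ?i z \<in> arrangement X R n"
        unfolding arrangement_eq using lab i by blast
      moreover have "layer_of X n P \<subseteq> H_pt X n ?i z"
        using layer_ofD(1)[of _ X n P] layer_ofD(3)[of _ X n P, OF _ B(1) i(2)] coord_int[of ?i] i(1)
        by (auto simp: H_pt_def)
      ultimately have "H_pt X n ?i z \<in> S"
        by (simp add: S_def)
      then have "y ?i = z" if "y \<in> Y" for y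
        using that by (auto simp: Y_def H_pt_def)
      then show ?thesis
        using k label_two_torsion[OF B(1)] two_torsionD(2)[of z]
        by (auto simp: torsion_coord_def coord_def abs_if split: if_splits)
    next
      case False
      then obtain j where j: "j \<in> B" "j \<noteq> k" "j \<noteq> - k"
        by blast
      have "\<bar>k\<bar> \<noteq> \<bar>j\<bar>" "\<bar>- k\<bar> \<noteq> \<bar>j\<bar>"
        using j by auto
      then show ?thesis
        using pair[OF _ BP B(2) j(1)] pair[OF _ BP k' j(1)] k by (simp add: torsion_coord_def)
    qed
  qed
  have "layer_of X n P = fibre n Y x"
  proof (intro equalityI subsetI)
    fix y assume y: "y \<in> layer_of X n P"
    have "coord X y k = coord X x k" if "torsion_coord n Y k" for k
    proof -
      have "coord X x k \<in> two_torsion X"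
        using torsion_coord_two_torsion[OF Y that] x PY by blast
      then show ?thesis
        using tors[of k] layer_ofD(3)[OF y] that by (auto simp: torsion_coord_def)
    qed
    then show "y \<in> fibre n Y x"
      using y PY by (auto simp: fibre_def)
  next
    fix y assume "y \<in> fibre n Y x"
    then have y: "y \<in> Y" and yT: "\<And>k. torsion_coord n Y k \<Longrightarrow> coord X y k = coord X x k"
      by (auto simp: fibre_def)
    have label: "coord X y k = z" if "snd P B = Some z" "k \<in> B" for B z k
      using yT[OF torsion[OF that]] layer_ofD(3)[OF x that] by simp
    show "y \<in> layer_of X n P"
    proof (rule layer_ofI)
      show "y \<in> cartesian_power X n"
        using y Y by blast
      show "coord X y k = z" if "snd P B = Some z" "k \<in> B" for B z k
        by (rule label[OF that])
      show "coord X y k = coord X y l" if B: "B \<in> fst P" "k \<in> B" "l \<in> B" for B k l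
      proof (cases "snd P B")
        case None
        then have "\<bar>k\<bar> \<noteq> \<bar>l\<bar> \<or> k = l"
          using unlabelled_uminus[OF B(1) None B(2)] B(3) by (auto simp: abs_eq_iff)
        then show ?thesis
          using pair[OF y B] by blast
      next
        case (Some z)
        then show ?thesis
          using label B by simp
      qed
    qed
  qed
  moreover have "S \<subseteq> arrangement X R n"
    by (auto simp: S_def)
  ultimately show ?thesis
    using x PY unfolding Y_def by blast
qed

theorem layers_eq: "layers X R n = layer_of X n ` label_partitions X R n"
proof (intro equalityI subsetI)
  fix K assume "K \<in> layers X R n"
  then obtain S where S: "S \<subseteq> arrangement X R n"
    and K: "K \<in> connected_components_of (subtopology (power_top X n) (cartesian_power X n \<inter> \<Inter>S))"
    by (auto simp: layers_def)
  then obtain x where x: "x \<in> cartesian_power X n \<inter> \<Inter>S"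
    and "K = connected_component_of_set (subtopology (power_top X n) (cartesian_power X n \<inter> \<Inter>S)) x"
    by (auto simp: connected_components_of_def)
  then show "K \<in> layer_of X n ` label_partitions X R n"
    using connected_component_eq_fibre[OF S refl x] fibre_eq_layer_of[OF S refl x] by fastforce
next
  fix K assume "K \<in> layer_of X n ` label_partitions X R n"
  then obtain P where P: "P \<in> label_partitions X R n" "K = layer_of X n P"
    by blast
  obtain S x where S: "S \<subseteq> arrangement X R n" and x: "x \<in> cartesian_power X n \<inter> \<Inter>S"
    and "layer_of X n P = fibre n (cartesian_power X n \<inter> \<Inter>S) x"
    using layer_of_eq_fibre[OF P(1)] by blast
  then have "K = connected_component_of_set (subtopology (power_top X n) (cartesian_power X n \<inter> \<Inter>S)) x"
    using connected_component_eq_fibre[OF S refl x] P(2) by simp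
  then have "K \<in> connected_components_of (subtopology (power_top X n) (cartesian_power X n \<inter> \<Inter>S))"
    using x by (auto simp: connected_components_of_def topspace_power_top)
  then show "K \<in> layers X R n"
    unfolding layers_def using S by blast
qed

end

section \<open>Codimension\<close>

lemma topspace_Cn: "topspace (Cn n) = {1..n} \<rightarrow>\<^sub>E UNIV"
  by (simp add: Cn_def)

lemma continuous_map_Cn_coord: "i \<in> {1..n} \<Longrightarrow> continuous_map (Cn n) euclidean (\<lambda>v. v i)"
  unfolding Cn_def by (rule continuous_map_product_coordinates)

lemma continuous_map_into_Cn:
  assumes "\<And>x. x \<in> topspace T \<Longrightarrow> f x \<in> extensional {1..n}"
    and "\<And>i. i \<in> {1..n} \<Longrightarrow> continuous_map T euclidean (\<lambda>x. f x i)"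
  shows "continuous_map T (Cn n) f"
  unfolding Cn_def continuous_map_componentwise using assms by auto

lemma biholomorphic_continuous:
  assumes "biholomorphic n U W \<psi>"
  shows "continuous_map (subtopology (Cn n) U) (Cn n) \<psi>"
    and "continuous_map (subtopology (Cn n) W) (Cn n) (inv_into U \<psi>)"
proof -
  have U: "U \<subseteq> {1..n} \<rightarrow>\<^sub>E UNIV" and W: "W \<subseteq> {1..n} \<rightarrow>\<^sub>E UNIV" and bij: "bij_betw \<psi> U W"
    using assms openin_subset[of "Cn n"] unfolding biholomorphic_def topspace_Cn by blast+
  show "continuous_map (subtopology (Cn n) U) (Cn n) \<psi>"
  proof (rule continuous_map_into_Cn)
    show "\<psi> v \<in> extensional {1..n}" if "v \<in> topspace (subtopology (Cn n) U)" for v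
      using that W bij_betwE[OF bij] by (auto simp: PiE_def)
  qed (use assms in \<open>simp add: biholomorphic_def holomorphic_fun_def\<close>)
  show "continuous_map (subtopology (Cn n) W) (Cn n) (inv_into U \<psi>)"
  proof (rule continuous_map_into_Cn)
    show "inv_into U \<psi> w \<in> extensional {1..n}" if "w \<in> topspace (subtopology (Cn n) W)" for w
      using that U bij_betwE[OF bij_betw_inv_into[OF bij]] by (auto simp: PiE_def)
  qed (use assms in \<open>simp add: biholomorphic_def holomorphic_fun_def\<close>)
qed

lemma continuous_map_Euclidean_space_coord:
  "continuous_map (Euclidean_space d) euclideanreal (\<lambda>x. x i)"
  unfolding Euclidean_space_def
  by (intro continuous_map_from_subtopology continuous_map_product_coordinates) simp

lemma continuous_map_Complex:
  assumes "continuous_map T euclideanreal f" "continuous_map T euclideanreal g"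
  shows "continuous_map T euclidean (\<lambda>x. Complex (f x) (g x))"
proof -
  have "continuous_on UNIV complex_of_real" "continuous_on UNIV (\<lambda>t. \<i> * complex_of_real t)"
    by (auto intro!: continuous_intros)
  then have "continuous_map T euclidean (\<lambda>x. complex_of_real (f x))"
    "continuous_map T euclidean (\<lambda>x. \<i> * complex_of_real (g x))"
    using continuous_map_compose[OF assms(1), of euclidean complex_of_real]
      continuous_map_compose[OF assms(2), of euclidean "\<lambda>t. \<i> * complex_of_real t"]
    by (simp_all add: o_def)
  then show ?thesis
    unfolding Complex_eq by (rule continuous_map_add)
qed

text \<open>
  If \<open>k < k'\<close>, the chart \<open>\<psi>\<close> identifies the common zero locus near \<open>a\<close> with an open subset of
  \<open>\<complex>\<close>-dimension \<open>n - k\<close>, which \<open>\<psi>'\<close> maps injectively into a proper coordinate subspace, against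
  invariance of domain.  Coordinates are enumerated from \<open>n\<close> downwards, so that \<open>n - m div 2\<close> is
  the complex coordinate containing the \<open>m\<close>-th real one.
\<close>

lemma biholomorphic_codim_le:
  assumes \<psi>: "biholomorphic n U W \<psi>" and \<psi>': "biholomorphic n U' W' \<psi>'"
    and a: "a \<in> U" "a \<in> U'" "\<forall>i\<in>{1..k}. \<psi> a i = 0" and k': "k' \<le> n"
    and locus: "\<And>v. v \<in> U \<Longrightarrow> v \<in> U' \<Longrightarrow> (\<forall>i\<in>{1..k}. \<psi> v i = 0) \<longleftrightarrow> (\<forall>i\<in>{1..k'}. \<psi>' v i = 0)"
  shows "k' \<le> k"
proof (rule ccontr)
  assume "\<not> k' \<le> k"
  then have kk': "k < k'"
    by simp
  define d where "d = n - k"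
  have d: "0 < d" "d \<le> n" "n - (d - 1) = k + 1"
    using kk' k' by (auto simp: d_def)
  let ?E = "Euclidean_space (2 * d)"
  \<comment> \<open>\<open>u\<close> embeds real 2d-space as the subspace of \<complex>^n where the
    first k coordinates vanish, and \<open>e\<close> reads the real coordinates back. Complex
    coordinate j occupies the real slots 2(n - j) and 2(n - j) + 1.\<close>
  define u :: "(nat \<Rightarrow> real) \<Rightarrow> nat \<Rightarrow> complex" where
    "u x = (\<lambda>j\<in>{1..n}. if j \<le> k then 0 else Complex (x (2 * (n - j))) (x (2 * (n - j) + 1)))" for x
  define e :: "(nat \<Rightarrow> complex) \<Rightarrow> nat \<Rightarrow> real" where
    "e w = (\<lambda>m. if m < 2 * d then (if even m then Re (w (n - m div 2)) else Im (w (n - m div 2))) else 0)" for w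
  note bij = \<psi>[unfolded biholomorphic_def, THEN conjunct2, THEN conjunct2, THEN conjunct1]
  note bij' = \<psi>'[unfolded biholomorphic_def, THEN conjunct2, THEN conjunct2, THEN conjunct1]
  have W: "openin (Cn n) W" and U: "openin (Cn n) U" and U': "openin (Cn n) U'"
    using \<psi> \<psi>' by (auto simp: biholomorphic_def)
  have Wsub: "W \<subseteq> {1..n} \<rightarrow>\<^sub>E UNIV" and W'sub: "W' \<subseteq> {1..n} \<rightarrow>\<^sub>E UNIV"
    using \<psi> \<psi>' openin_subset[of "Cn n"] unfolding biholomorphic_def topspace_Cn by blast+
  have u_cont: "continuous_map ?E (Cn n) u"
  proof (rule continuous_map_into_Cn)
    show "continuous_map ?E euclidean (\<lambda>x. u x j)" if "j \<in> {1..n}" for j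
      using that unfolding u_def
      by (cases "j \<le> k") (auto intro!: continuous_map_Complex continuous_map_Euclidean_space_coord)
  qed (simp add: u_def)
  have e_cont: "continuous_map (Cn n) ?E e"
    unfolding e_def
  proof (subst continuous_map_componentwise_Euclidean_space, intro allI impI)
    fix m assume "m < 2 * d"
    then have "n - m div 2 \<in> {1..n}"
      using d by auto
    from continuous_map_Cn_coord[OF this]
    have "continuous_map (Cn n) euclideanreal (\<lambda>w. Re (w (n - m div 2)))"
      "continuous_map (Cn n) euclideanreal (\<lambda>w. Im (w (n - m div 2)))"
      using continuous_map_compose[of "Cn n" euclidean "\<lambda>w. w (n - m div 2)" euclidean Re]
        continuous_map_compose[of "Cn n" euclidean "\<lambda>w. w (n - m div 2)" euclidean Im]
      by (simp_all add: o_def continuous_on_Re continuous_on_Im)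
    then show "continuous_map (Cn n) euclideanreal
        (\<lambda>w. if even m then Re (w (n - m div 2)) else Im (w (n - m div 2)))"
      by (cases "even m") auto
  qed
  have ue: "u (e w) = w" if "w \<in> {1..n} \<rightarrow>\<^sub>E UNIV" "\<forall>i\<in>{1..k}. w i = 0" for w
  proof
    fix j show "u (e w) j = w j"
    proof (cases "j \<in> {1..n} \<and> k < j")
      case True
      then have "2 * (n - j) < 2 * d" "2 * (n - j) + 1 < 2 * d" "n - (n - j) = j"
        by (auto simp: d_def)
      then show ?thesis
        using True by (simp add: u_def e_def)
    next
      case False
      then show ?thesis
        using that by (auto simp: u_def PiE_def extensional_def)
    qed
  qed
  have eu: "e (u x) = x" if "x \<in> topspace ?E" for x
  proof
    fix m show "e (u x) m = x m"
    proof (cases "m < 2 * d")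
      case True
      then have 1: "n - m div 2 \<in> {1..n}" "\<not> n - m div 2 \<le> k" "n - (n - m div 2) = m div 2"
        using d by (auto simp: d_def)
      show ?thesis
      proof (cases "even m")
        case even: True
        then show ?thesis
          using True 1 by (simp add: e_def u_def)
      next
        case False
        then have "Suc (2 * (m div 2)) = m"
          by presburger
        then show ?thesis
          using True False 1 by (simp add: e_def u_def)
      qed
    next
      case False
      then show ?thesis
        using that by (simp add: e_def topspace_Euclidean_space)
    qed
  qed
  have u_zero: "\<forall>i\<in>{1..k}. u x i = 0" for x
    using kk' k' by (auto simp: u_def)
  \<comment> \<open>\<open>V\<close> is the part of \<open>W\<close> whose points come from the
    overlap of both domains, so that \<psi>' can be applied after the inverse of \<psi>.\<close>
  define V where "V = {w \<in> W. inv_into U \<psi> w \<in> U'}"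
  have "openin (subtopology (Cn n) W) {w \<in> topspace (subtopology (Cn n) W). inv_into U \<psi> w \<in> U'}"
    by (rule openin_continuous_map_preimage[OF biholomorphic_continuous(2)[OF \<psi>] U'])
  moreover have "topspace (subtopology (Cn n) W) = W"
    using openin_subset[OF W] by auto
  ultimately have "openin (subtopology (Cn n) W) V"
    by (simp only: V_def)
  then have V: "openin (Cn n) V"
    using W openin_trans_full by blast
  define N where "N = {x \<in> topspace ?E. u x \<in> V}"
  have N: "openin ?E N"
    unfolding N_def by (rule openin_continuous_map_preimage[OF u_cont V])
  define F where "F = e \<circ> \<psi>' \<circ> inv_into U \<psi> \<circ> u"
  have u_map: "continuous_map (subtopology ?E N) (subtopology (Cn n) V) u"
    using continuous_map_from_subtopology[OF u_cont] by (auto simp: continuous_map_in_subtopology N_def)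
  have i_map: "continuous_map (subtopology (Cn n) V) (subtopology (Cn n) U') (inv_into U \<psi>)"
    using continuous_map_from_subtopology_mono[OF biholomorphic_continuous(2)[OF \<psi>], of V]
    by (auto simp: continuous_map_in_subtopology V_def)
  have F_cont: "continuous_map (subtopology ?E N) ?E F"
    unfolding F_def
    by (intro continuous_map_compose[OF u_map] continuous_map_compose[OF i_map]
        continuous_map_compose[OF biholomorphic_continuous(1)[OF \<psi>']] e_cont)
  have point: "inv_into U \<psi> (u x) \<in> U" "inv_into U \<psi> (u x) \<in> U'" "\<psi> (inv_into U \<psi> (u x)) = u x"
      "\<psi>' (inv_into U \<psi> (u x)) \<in> {1..n} \<rightarrow>\<^sub>E UNIV"
      "\<forall>i\<in>{1..k'}. \<psi>' (inv_into U \<psi> (u x)) i = 0" if "x \<in> N" for x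
  proof -
    have uW: "u x \<in> W" and *: "inv_into U \<psi> (u x) \<in> U'"
      using that by (auto simp: N_def V_def)
    show 1: "inv_into U \<psi> (u x) \<in> U" and 2: "\<psi> (inv_into U \<psi> (u x)) = u x"
      using bij_betwE[OF bij_betw_inv_into[OF bij]] uW bij_betw_inv_into_right[OF bij] by blast+
    show "inv_into U \<psi> (u x) \<in> U'"
      by (rule *)
    show "\<psi>' (inv_into U \<psi> (u x)) \<in> {1..n} \<rightarrow>\<^sub>E UNIV"
      using bij_betwE[OF bij'] * W'sub by blast
    show "\<forall>i\<in>{1..k'}. \<psi>' (inv_into U \<psi> (u x)) i = 0"
      using locus[OF 1 *] u_zero 2 by simp
  qed
  have F_inj: "inj_on F N"
  proof (rule inj_onI)
    fix x y assume x: "x \<in> N" and y: "y \<in> N" and eq: "F x = F y"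
    \<comment> \<open>The image under \<psi>' has its first k' coordinates zero, in particular the
      first k. On such points \<open>e\<close> forgets nothing, so injectivity of \<open>F\<close>
      reduces to that of \<psi>'.\<close>
    have ue': "u (F z) = \<psi>' (inv_into U \<psi> (u z))" if "z \<in> N" for z
      unfolding F_def o_def using ue[OF point(4)[OF that]] point(5)[OF that] kk' by simp
    have "\<psi>' (inv_into U \<psi> (u x)) = \<psi>' (inv_into U \<psi> (u y))"
      using ue'[OF x] ue'[OF y] eq by simp
    then have "inv_into U \<psi> (u x) = inv_into U \<psi> (u y)"
      using bij_betw_imp_inj_on[OF bij'] point(2) x y by (meson inj_onD)
    then have "u x = u y"
      using point(3) x y by metis
    then show "x = y"
      using eu x y unfolding N_def by (metis (no_types, lifting) mem_Collect_eq)
  qed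
  have open_image: "openin ?E (F ` N)"
    by (rule invariance_of_domain_Euclidean_space[OF N F_cont F_inj])
  \<comment> \<open>This real slot holds the real part of complex coordinate n - (d - 1) = k + 1. As
    k + 1 \<le> k', that coordinate vanishes on the whole image of \<open>F\<close>.\<close>
  let ?m = "2 * (d - 1)"
  have zero: "p ?m = 0" if "p \<in> F ` N" for p
  proof -
    obtain x where x: "x \<in> N" "p = F x"
      using \<open>p \<in> F ` N\<close> by blast
    have "k + 1 \<in> {1..k'}"
      using kk' by simp
    then have "\<psi>' (inv_into U \<psi> (u x)) (k + 1) = 0"
      using point(5)[OF x(1)] by blast
    then show ?thesis
      using d by (simp add: x(2) F_def e_def)
  qed
  have \<psi>a: "\<psi> a \<in> W"
    using bij_betwE[OF bij] a(1) by blast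
  have uea: "u (e (\<psi> a)) = \<psi> a"
    using ue a(3) \<psi>a Wsub by blast
  have "e (\<psi> a) \<in> N"
    using uea \<psi>a a bij_betw_inv_into_left[OF bij a(1)]
    by (simp add: N_def V_def topspace_Euclidean_space e_def)
  then obtain p where p: "p \<in> F ` N"
    by blast
  \<comment> \<open>The line through \<open>p\<close> in the direction of slot \<open>?m\<close>. It
    meets the image of \<open>F\<close> only at t = 0, whereas the preimage of an open set under it
    must be open.\<close>
  define c where "c t = (\<lambda>i. if i < 2 * d then (if i = ?m then t else p i) else 0)" for t :: real
  have c: "continuous_map euclideanreal ?E c"
    unfolding c_def
  proof (subst continuous_map_componentwise_Euclidean_space, intro allI impI)
    show "continuous_map euclideanreal euclideanreal (\<lambda>t. if i = ?m then t else p i)" for i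
      by (cases "i = ?m") auto
  qed
  have "openin euclideanreal {t \<in> topspace euclideanreal. c t \<in> F ` N}"
    by (rule openin_continuous_map_preimage[OF c open_image])
  moreover have "{t. c t \<in> F ` N} = {0}"
  proof -
    have "p \<in> topspace ?E"
      using p openin_subset[OF open_image] by blast
    then have "c 0 = p"
      using zero[OF p] by (auto simp: c_def topspace_Euclidean_space)
    moreover have "t = 0" if "c t \<in> F ` N" for t
      using zero[OF that] d by (simp add: c_def)
    ultimately show ?thesis
      using p by auto
  qed
  ultimately have "open {0 :: real}"
    by simp
  then show False
    using not_open_singleton by blast
qed

section \<open>Holomorphic functions of several variables and shears\<close>

lemma continuous_map_fun_upd_Cn:
  assumes "a \<in> {1..n} \<rightarrow>\<^sub>E UNIV" "i \<in> {1..n}"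
  shows "continuous_map euclidean (Cn n) (\<lambda>t. a(i := t))"
proof (rule continuous_map_into_Cn)
  show "continuous_map euclidean euclidean (\<lambda>t. (a(i := t)) j)" for j
    by (cases "j = i") auto
qed (use assms in \<open>auto simp: PiE_def extensional_def\<close>)

lemma openin_Cn_slice:
  assumes "openin (Cn n) U" "a \<in> U" "i \<in> {1..n}"
  shows "open {t. a(i := t) \<in> U}"
proof -
  have "a \<in> {1..n} \<rightarrow>\<^sub>E UNIV"
    using assms openin_subset topspace_Cn by blast
  then show ?thesis
    using openin_continuous_map_preimage[OF continuous_map_fun_upd_Cn assms(1)] assms(3) by simp
qed

text \<open>Differentiability in one variable sees the function on a neighbourhood of the point.
  Openness of \<open>U\<close> provides such a neighbourhood in each coordinate slice, on which the
  two functions agree.\<close>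

lemma holomorphic_fun_cong:
  assumes U: "openin (Cn n) U" and eq: "\<And>v. v \<in> U \<Longrightarrow> f v = g v" and f: "holomorphic_fun n U f"
  shows "holomorphic_fun n U g"
  unfolding holomorphic_fun_def
proof (intro conjI ballI)
  show "continuous_map (subtopology (Cn n) U) euclidean g"
    using f eq by (auto simp: holomorphic_fun_def intro: continuous_map_eq)
  fix a i assume a: "a \<in> U" and i: "i \<in> {1..n}"
  show "(\<lambda>t. g (a(i := t))) field_differentiable at (a i)"
  proof -
    obtain D where "((\<lambda>t. f (a(i := t))) has_field_derivative D) (at (a i))"
      using f a i unfolding holomorphic_fun_def field_differentiable_def by blast
    then have "((\<lambda>t. g (a(i := t))) has_field_derivative D) (at (a i))"
      by (rule has_field_derivative_transform_within_open[OF _ openin_Cn_slice[OF U a i]])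
        (use a eq in auto)
    then show ?thesis
      by (auto simp: field_differentiable_def)
  qed
qed

lemma holomorphic_fun_subset:
  "holomorphic_fun n U f \<Longrightarrow> W \<subseteq> U \<Longrightarrow> holomorphic_fun n W f"
  unfolding holomorphic_fun_def using continuous_map_from_subtopology_mono by blast

lemma holomorphic_fun_const: "holomorphic_fun n U (\<lambda>v. c)"
  by (simp add: holomorphic_fun_def)

lemma holomorphic_fun_add:
  "holomorphic_fun n U f \<Longrightarrow> holomorphic_fun n U g \<Longrightarrow> holomorphic_fun n U (\<lambda>v. f v + g v)"
  by (auto simp: holomorphic_fun_def intro: continuous_map_add field_differentiable_add)

lemma holomorphic_fun_diff:
  "holomorphic_fun n U f \<Longrightarrow> holomorphic_fun n U g \<Longrightarrow> holomorphic_fun n U (\<lambda>v. f v - g v)"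
  by (auto simp: holomorphic_fun_def intro: continuous_map_diff field_differentiable_diff)

lemma holomorphic_fun_compose_coord:
  assumes g: "g holomorphic_on V" and V: "open V" and r: "r \<in> {1..n}" and U: "\<And>v. v \<in> U \<Longrightarrow> v r \<in> V"
  shows "holomorphic_fun n U (\<lambda>v. g (v r))"
  unfolding holomorphic_fun_def
proof (intro conjI ballI)
  have "continuous_map (subtopology (Cn n) U) (subtopology euclidean V) (\<lambda>v. v r)"
    using continuous_map_from_subtopology[OF continuous_map_Cn_coord[OF r]] U
    by (auto simp: continuous_map_in_subtopology)
  moreover have "continuous_map (subtopology euclidean V) euclidean g"
    using holomorphic_on_imp_continuous_on[OF g] by simp
  ultimately show "continuous_map (subtopology (Cn n) U) euclidean (\<lambda>v. g (v r))"
    using continuous_map_compose[of "subtopology (Cn n) U" "subtopology euclidean V" "\<lambda>v. v r" euclidean g]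
    by (simp add: o_def)
  fix a i assume a: "a \<in> U" and i: "i \<in> {1..n}"
  have "g field_differentiable at (a r)"
    using holomorphic_on_imp_differentiable_at[OF g V] U[OF a] by blast
  then show "(\<lambda>t. g ((a(i := t)) r)) field_differentiable at (a i)"
    by (cases "i = r") auto
qed

lemma holomorphic_fun_coord: "r \<in> {1..n} \<Longrightarrow> holomorphic_fun n U (\<lambda>v. v r)"
  using holomorphic_fun_compose_coord[of "\<lambda>z. z" UNIV r n U] by (simp add: holomorphic_on_ident)

lemma holomorphic_fun_permute:
  assumes f: "holomorphic_fun n D f" and \<pi>: "\<pi> permutes {1..n}"
  shows "holomorphic_fun n {w \<in> {1..n} \<rightarrow>\<^sub>E UNIV. (\<lambda>i\<in>{1..n}. w (inv_into UNIV \<pi> i)) \<in> D}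
    (\<lambda>w. f (\<lambda>i\<in>{1..n}. w (inv_into UNIV \<pi> i)))"
  unfolding holomorphic_fun_def
proof (intro conjI ballI)
  let ?p = "\<lambda>w. \<lambda>i\<in>{1..n}. w (inv_into UNIV \<pi> i)"
  let ?D = "{w \<in> {1..n} \<rightarrow>\<^sub>E UNIV. ?p w \<in> D}"
  have inv: "inv_into UNIV \<pi> i \<in> {1..n}" if "i \<in> {1..n}" for i
    using permutes_in_image[OF permutes_inv[OF \<pi>]] that by blast
  have "continuous_map (Cn n) (Cn n) ?p"
    by (rule continuous_map_into_Cn) (simp_all add: continuous_map_Cn_coord inv del: atLeastAtMost_iff One_nat_def)
  then have "continuous_map (subtopology (Cn n) ?D) (subtopology (Cn n) D) ?p"
    by (auto simp: continuous_map_in_subtopology continuous_map_from_subtopology)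
  then show "continuous_map (subtopology (Cn n) ?D) euclidean (\<lambda>w. f (?p w))"
    using f continuous_map_compose[of "subtopology (Cn n) ?D" "subtopology (Cn n) D" ?p euclidean f]
    by (simp add: o_def holomorphic_fun_def)
  fix a i assume a: "a \<in> ?D" and i: "i \<in> {1..n}"
  have \<pi>i: "\<pi> i \<in> {1..n}" "inv_into UNIV \<pi> (\<pi> i) = i"
    using permutes_in_image[OF \<pi>] i permutes_inverses(2)[OF \<pi>] by auto
  have "?p (a(i := t)) = (?p a)(\<pi> i := t)" for t
    using \<pi>i permutes_inverses(1)[OF \<pi>] by (auto simp: fun_eq_iff)
  moreover have "(\<lambda>t. f ((?p a)(\<pi> i := t))) field_differentiable at (?p a (\<pi> i))"
    using f a \<pi>i(1) unfolding holomorphic_fun_def by blast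
  moreover have "?p a (\<pi> i) = a i"
    using \<pi>i by simp
  ultimately show "(\<lambda>t. f (?p (a(i := t)))) field_differentiable at (a i)"
    by (simp only:)
qed

text \<open>Subtracting from the coordinates in \<open>B\<close> functions of the others is undone
  by adding them back, because the others are untouched. The permutation \<pi> reorders the result,
  to bring \<open>B\<close> to the front as \<open>has_codim\<close> expects. The domain of
  \<open>h\<close> is unrestricted in the directions of \<open>B\<close>, because the inverse
  evaluates \<open>h\<close> at points whose \<open>B\<close>-coordinates are still shifted.\<close>

lemma biholomorphic_shear:
  fixes h :: "nat \<Rightarrow> (nat \<Rightarrow> complex) \<Rightarrow> complex"
  assumes U: "\<And>i. i \<in> {1..n} \<Longrightarrow> open (U i)" and \<pi>: "\<pi> permutes {1..n}"
    and hol: "\<And>i. i \<in> B \<Longrightarrow> holomorphic_fun n (\<Pi>\<^sub>E j\<in>{1..n}. if j \<in> B then UNIV else U j) (h i)"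
    and dep: "\<And>i v v'. i \<in> B \<Longrightarrow> (\<And>j. j \<in> {1..n} - B \<Longrightarrow> v j = v' j) \<Longrightarrow> h i v = h i v'"
  shows "\<exists>W. biholomorphic n (\<Pi>\<^sub>E j\<in>{1..n}. U j) W
    (\<lambda>v. \<lambda>j\<in>{1..n}. if \<pi> j \<in> B then v (\<pi> j) - h (\<pi> j) v else v (\<pi> j))"
proof -
  define H where "H i v = (if i \<in> B then h i v else 0)" for i v
  let ?D = "\<Pi>\<^sub>E j\<in>{1..n}. if j \<in> B then UNIV else U j"
  let ?U = "\<Pi>\<^sub>E j\<in>{1..n}. U j"
  have Hhol: "holomorphic_fun n ?D (H i)" for i
    using hol[of i] holomorphic_fun_const[of n ?D 0] by (cases "i \<in> B") (simp_all add: H_def[abs_def])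
  have Hdep: "H i v = H i v'" if "\<And>j. j \<in> {1..n} - B \<Longrightarrow> v j = v' j" for i v v'
    using dep[of i v v'] that by (simp add: H_def)
  define \<psi> where "\<psi> v = (\<lambda>j\<in>{1..n}. v (\<pi> j) - H (\<pi> j) v)" for v
  \<comment> \<open>\<open>p\<close> undoes the reordering and \<theta> adds the subtracted
    functions back, so \<theta> is the inverse of \<psi>. The image \<open>W\<close> is then
    described explicitly as the set of points that \<theta> sends into the original domain.\<close>
  define p where "p w = (\<lambda>i\<in>{1..n}. w (inv_into UNIV \<pi> i))" for w :: "nat \<Rightarrow> complex"
  define \<theta> where "\<theta> w = (\<lambda>i\<in>{1..n}. p w i + H i (p w))" for w
  define D' where "D' = {w \<in> {1..n} \<rightarrow>\<^sub>E UNIV. p w \<in> ?D}"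
  define W where "W = {w \<in> D'. \<theta> w \<in> ?U}"
  have inv: "inv_into UNIV \<pi> i \<in> {1..n}" if "i \<in> {1..n}" for i
    using permutes_in_image[OF permutes_inv[OF \<pi>]] that by blast
  have \<pi>in: "\<pi> i \<in> {1..n}" if "i \<in> {1..n}" for i
    using permutes_in_image[OF \<pi>] that by blast
  have openU: "openin (Cn n) ?U" and openD: "openin (Cn n) ?D"
    unfolding Cn_def using U by (auto intro!: openin_PiE simp: openin_PiE_gen)
  have p_cont: "continuous_map (Cn n) (Cn n) p"
    by (rule continuous_map_into_Cn) (simp_all add: p_def continuous_map_Cn_coord inv del: atLeastAtMost_iff One_nat_def)
  have openD': "openin (Cn n) D'"
    using openin_continuous_map_preimage[OF p_cont openD] by (simp add: D'_def topspace_Cn)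
  have \<theta>hol: "holomorphic_fun n D' (\<lambda>w. \<theta> w i)" if "i \<in> {1..n}" for i
  proof -
    have "holomorphic_fun n D' (\<lambda>w. H i (p w))"
      using holomorphic_fun_permute[OF Hhol \<pi>] by (simp add: D'_def p_def)
    then have "holomorphic_fun n D' (\<lambda>w. w (inv_into UNIV \<pi> i) + H i (p w))"
      using inv[OF that] by (intro holomorphic_fun_add holomorphic_fun_coord)
    then show ?thesis
      using that by (simp add: \<theta>_def p_def)
  qed
  have \<theta>_cont: "continuous_map (subtopology (Cn n) D') (Cn n) \<theta>"
  proof (rule continuous_map_into_Cn)
    show "continuous_map (subtopology (Cn n) D') euclidean (\<lambda>w. \<theta> w i)" if "i \<in> {1..n}" for i
      using \<theta>hol[OF that] by (simp add: holomorphic_fun_def)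
  qed (simp add: \<theta>_def)
  have "openin (subtopology (Cn n) D') {w \<in> topspace (subtopology (Cn n) D'). \<theta> w \<in> ?U}"
    by (rule openin_continuous_map_preimage[OF \<theta>_cont openU])
  moreover have "topspace (subtopology (Cn n) D') = D'"
    using openin_subset[OF openD'] by auto
  ultimately have "openin (subtopology (Cn n) D') W"
    by (simp only: W_def)
  then have openW: "openin (Cn n) W"
    using openD' openin_trans_full by blast
  have p\<psi>: "p (\<psi> v) i = v i - H i v" if "i \<in> {1..n}" for v i
    using that inv[OF that] permutes_inverses(1)[OF \<pi>] by (simp add: p_def \<psi>_def)
  have \<theta>\<psi>: "\<theta> (\<psi> v) = v" if v: "v \<in> ?U" for v
  proof (rule extensionalityI[of _ "{1..n}"])
    fix i assume i: "i \<in> {1..n}"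
    have "H i (p (\<psi> v)) = H i v"
      by (rule Hdep) (simp add: p\<psi> H_def)
    then show "\<theta> (\<psi> v) i = v i"
      using i by (simp add: \<theta>_def p\<psi>)
  qed (use v in \<open>auto simp: \<theta>_def PiE_def\<close>)
  have \<psi>W: "\<psi> v \<in> W" if v: "v \<in> ?U" for v
  proof -
    have "p (\<psi> v) \<in> extensional {1..n}"
      by (simp add: p_def)
    then have "p (\<psi> v) \<in> ?D"
      using v p\<psi> by (auto simp: PiE_iff H_def)
    then show ?thesis
      using v \<theta>\<psi>[OF v] by (simp add: W_def D'_def \<psi>_def)
  qed
  have \<psi>\<theta>: "\<psi> (\<theta> w) = w" if w: "w \<in> W" for w
  proof (rule extensionalityI[of _ "{1..n}"])
    fix j assume j: "j \<in> {1..n}"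
    have "H (\<pi> j) (\<theta> w) = H (\<pi> j) (p w)"
      by (rule Hdep) (simp add: \<theta>_def H_def)
    moreover have "p w (\<pi> j) = w j"
      using \<pi>in[OF j] permutes_inverses(2)[OF \<pi>] by (simp add: p_def)
    ultimately show "\<psi> (\<theta> w) j = w j"
      using j \<pi>in[OF j] by (simp add: \<psi>_def \<theta>_def)
  qed (use w in \<open>auto simp: \<psi>_def W_def D'_def PiE_def\<close>)
  have bij: "bij_betw \<psi> ?U W"
  proof (rule bij_betw_byWitness[of _ \<theta>])
    show "\<psi> ` ?U \<subseteq> W"
      using \<psi>W by blast
    show "\<theta> ` W \<subseteq> ?U"
      unfolding W_def by blast
  qed (use \<psi>\<theta> \<theta>\<psi> in blast)+
  have \<psi>hol: "holomorphic_fun n ?U (\<lambda>v. \<psi> v j)" if j: "j \<in> {1..n}" for j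
  proof -
    have "?U \<subseteq> ?D"
      by (auto simp: PiE_iff)
    then have "holomorphic_fun n ?U (\<lambda>v. v (\<pi> j) - H (\<pi> j) v)"
      by (intro holomorphic_fun_diff holomorphic_fun_coord \<pi>in[OF j] holomorphic_fun_subset[OF Hhol])
    then show ?thesis
      using j by (simp add: \<psi>_def)
  qed
  have invhol: "holomorphic_fun n W (\<lambda>w. inv_into ?U \<psi> w i)" if i: "i \<in> {1..n}" for i
  proof (rule holomorphic_fun_cong[OF openW])
    show "holomorphic_fun n W (\<lambda>w. \<theta> w i)"
      using \<theta>hol[OF i] by (rule holomorphic_fun_subset) (auto simp: W_def)
    fix w assume w: "w \<in> W"
    then have "inv_into ?U \<psi> w = \<theta> w"
      using inv_into_f_f[OF bij_betw_imp_inj_on[OF bij], of "\<theta> w"] \<psi>\<theta>[OF w] by (simp add: W_def)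
    then show "\<theta> w i = inv_into ?U \<psi> w i"
      by simp
  qed
  have "biholomorphic n ?U W \<psi>"
    unfolding biholomorphic_def using openU openW bij \<psi>hol invhol by blast
  moreover have "\<psi> = (\<lambda>v. \<lambda>j\<in>{1..n}. if \<pi> j \<in> B then v (\<pi> j) - h (\<pi> j) v else v (\<pi> j))"
    by (auto simp: \<psi>_def H_def fun_eq_iff)
  ultimately show ?thesis
    by blast
qed

lemma ex_permutes_image:
  assumes B: "B \<subseteq> {1..n}" and k: "card B = k"
  shows "\<exists>\<pi>. \<pi> permutes {1..n} \<and> \<pi> ` {1..k} = B"
proof -
  have "k \<le> n"
    using card_mono[OF _ B] k by simp
  then have K: "{1..k} \<subseteq> {1..n}"
    by auto
  have fin: "finite B"
    using B finite_subset by blast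
  obtain f where f: "bij_betw f {1..k} B"
    using finite_same_card_bij[of "{1..k}" B] fin k by auto
  have "card ({1..n} - {1..k}) = card ({1..n} - B)"
    using card_Diff_subset[OF _ K] card_Diff_subset[OF fin B] k by simp
  then obtain g where g: "bij_betw g ({1..n} - {1..k}) ({1..n} - B)"
    using finite_same_card_bij[of "{1..n} - {1..k}" "{1..n} - B"] by auto
  define \<pi> where "\<pi> i = (if i \<in> {1..k} then f i else if i \<in> {1..n} then g i else i)" for i
  have 1: "bij_betw \<pi> {1..k} B"
    using f by (rule bij_betw_cong[THEN iffD1, rotated]) (simp add: \<pi>_def)
  have "bij_betw \<pi> ({1..n} - {1..k}) ({1..n} - B)"
    using g by (rule bij_betw_cong[THEN iffD1, rotated]) (auto simp: \<pi>_def)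
  then have "bij_betw \<pi> ({1..k} \<union> ({1..n} - {1..k})) (B \<union> ({1..n} - B))"
    using bij_betw_combine[OF 1] by blast
  then have "bij_betw \<pi> {1..n} {1..n}"
    using K B by (simp add: Un_absorb1)
  then have "\<pi> permutes {1..n}"
    using K by (intro bij_imp_permutes) (auto simp: \<pi>_def)
  then show ?thesis
    using bij_betw_imp_surj_on[OF 1] by blast
qed

section \<open>Uniqueness of codimension in powers of the curve\<close>

context curve
begin

lemma ex_params:
  assumes "y \<in> cartesian_power X n"
  obtains V \<phi> a where "\<And>i. i \<in> {1..n} \<Longrightarrow> (V i, \<phi> i) \<in> params X" "a \<in> {1..n} \<rightarrow>\<^sub>E UNIV"
    "\<And>i. i \<in> {1..n} \<Longrightarrow> a i \<in> V i" "(\<lambda>i\<in>{1..n}. \<phi> i (a i)) = y"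
proof -
  have "\<forall>i\<in>{1..n}. \<exists>c. (fst c, fst (snd c)) \<in> params X \<and> snd (snd c) \<in> fst c \<and> fst (snd c) (snd (snd c)) = y i"
    using params_cover[OF cartesian_power_closed[OF assms]] by fastforce
  then obtain c where c: "\<forall>i\<in>{1..n}. (fst (c i), fst (snd (c i))) \<in> params X \<and>
      snd (snd (c i)) \<in> fst (c i) \<and> fst (snd (c i)) (snd (snd (c i))) = y i"
    by (rule bchoice[THEN exE])
  show thesis
  proof
    show "(fst (c i), fst (snd (c i))) \<in> params X" if "i \<in> {1..n}" for i
      using c that by blast
    show "restrict (\<lambda>i. snd (snd (c i))) {1..n} i \<in> fst (c i)" if "i \<in> {1..n}" for i
      using c that by simp
    show "(\<lambda>i\<in>{1..n}. fst (snd (c i)) (restrict (\<lambda>i. snd (snd (c i))) {1..n} i)) = y"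
      using c assms by (auto simp: cartesian_power_def PiE_def extensional_def fun_eq_iff)
  qed (simp only: restrict_PiE_iff, simp)
qed

text \<open>Both straightenings are compared in one chart around the point \<open>y\<close>. Without
  a point the claim would fail: the condition in \<open>has_codim\<close> is vacuous for the empty
  set.\<close>

lemma has_codim_le:
  assumes k: "has_codim X n Y k" and k': "has_codim X n Y k'" and y: "y \<in> Y"
  shows "k' \<le> k"
proof -
  have "y \<in> cartesian_power X n"
    using k y by (auto simp: has_codim_def)
  then obtain V \<phi> a where chart: "\<And>i. i \<in> {1..n} \<Longrightarrow> (V i, \<phi> i) \<in> params X" "a \<in> {1..n} \<rightarrow>\<^sub>E UNIV"
    "\<And>i. i \<in> {1..n} \<Longrightarrow> a i \<in> V i" "(\<lambda>i\<in>{1..n}. \<phi> i (a i)) = y"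
    by (rule ex_params) (rule that, assumption+)
  have "(\<forall>i\<in>{1..n}. (V i, \<phi> i) \<in> params X) \<and> a \<in> {1..n} \<rightarrow>\<^sub>E UNIV \<and> (\<forall>i\<in>{1..n}. a i \<in> V i) \<and>
      (\<lambda>i\<in>{1..n}. \<phi> i (a i)) \<in> Y"
    using chart y by blast
  then have ex: "\<exists>U W \<psi>. a \<in> U \<and> U \<subseteq> Pi\<^sub>E {1..n} V \<and> biholomorphic n U W \<psi> \<and>
      (\<forall>v\<in>U. (\<lambda>i\<in>{1..n}. \<phi> i (v i)) \<in> Y \<longleftrightarrow> (\<forall>i\<in>{1..m}. \<psi> v i = 0))" if "has_codim X n Y m" for m
    using that unfolding has_codim_def by blast
  obtain U W \<psi> where U: "a \<in> U" "biholomorphic n U W \<psi>"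
      "\<forall>v\<in>U. (\<lambda>i\<in>{1..n}. \<phi> i (v i)) \<in> Y \<longleftrightarrow> (\<forall>i\<in>{1..k}. \<psi> v i = 0)"
    using ex[OF k] by blast
  obtain U' W' \<psi>' where U': "a \<in> U'" "biholomorphic n U' W' \<psi>'"
      "\<forall>v\<in>U'. (\<lambda>i\<in>{1..n}. \<phi> i (v i)) \<in> Y \<longleftrightarrow> (\<forall>i\<in>{1..k'}. \<psi>' v i = 0)"
    using ex[OF k'] by blast
  show ?thesis
  proof (rule biholomorphic_codim_le[OF U(2) U'(2) U(1) U'(1)])
    show "\<forall>i\<in>{1..k}. \<psi> a i = 0"
      using U(1,3) chart(4) y by blast
    show "k' \<le> n"
      using k' by (simp add: has_codim_def)
    show "(\<forall>i\<in>{1..k}. \<psi> v i = 0) \<longleftrightarrow> (\<forall>i\<in>{1..k'}. \<psi>' v i = 0)" if "v \<in> U" "v \<in> U'" for v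
      using U(3) U'(3) that by blast
  qed
qed

end

section \<open>Rank of a partition and codimension of its layer\<close>

context curve_partition
begin

definition rep_indices :: "nat set" where
  "rep_indices = {i \<in> {1..n}. snd P (block (int i)) = None \<and> rep (int i) = int i}"

text \<open>An unlabelled part corresponds to its representative, and the representatives of S and
  its bar are opposite. So each such pair contributes exactly one positive representative.\<close>

lemma card_unlabelled_parts: "card (fst P - dom (snd P)) = 2 * card rep_indices"
proof -
  define K where "K = {k \<in> signed_set n. snd P (block k) = None \<and> rep k = k}"
  have "bij_betw block K (fst P - dom (snd P))"
  proof (rule bij_betwI')
    show "block k = block l \<longleftrightarrow> k = l" if "k \<in> K" "l \<in> K" for k l
      using rep_cong[of k l] that by (auto simp: K_def)
    show "block k \<in> fst P - dom (snd P)" if "k \<in> K" for k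
      using block_in(1)[of k] that by (auto simp: K_def)
    show "\<exists>k\<in>K. S = block k" if S: "S \<in> fst P - dom (snd P)" for S
    proof -
      obtain k where k: "k \<in> S"
        using part_nonempty S by blast
      then have kA: "k \<in> signed_set n" and bk: "block k = S"
        using S part_subset block_eq by blast+
      have "rep k \<in> K"
        using rep_signed[OF kA] block_rep[OF kA] rep_rep[OF kA] bk S by (auto simp: K_def)
      then show ?thesis
        using block_rep[OF kA] bk by auto
    qed
  qed
  then have "card (fst P - dom (snd P)) = card K"
    by (metis bij_betw_same_card)
  also have "K = int ` rep_indices \<union> (\<lambda>i. - int i) ` rep_indices"
  proof (intro equalityI subsetI)
    fix k assume k: "k \<in> K"
    then have kA: "k \<in> signed_set n"
      by (simp add: K_def)
    show "k \<in> int ` rep_indices \<union> (\<lambda>i. - int i) ` rep_indices"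
    proof (cases "0 < k")
      case True
      then have "nat k \<in> rep_indices" "k = int (nat k)"
        using k by (auto simp: K_def rep_indices_def signed_set_def)
      then show ?thesis
        by blast
    next
      case False
      have "snd P (block (- k)) = None" "rep (- k) = - k"
        using k unlabelled_block_uminus[OF kA] rep_uminus[OF kA] by (auto simp: K_def)
      then have "nat (- k) \<in> rep_indices" "k = - int (nat (- k))"
        using False kA by (auto simp: rep_indices_def signed_set_def)
      then show ?thesis
        by blast
    qed
  next
    fix k assume "k \<in> int ` rep_indices \<union> (\<lambda>i. - int i) ` rep_indices"
    then show "k \<in> K"
      using unlabelled_block_uminus rep_uminus
      by (auto simp: K_def rep_indices_def signed_set_def)
  qed
  also have "card \<dots> = card (int ` rep_indices) + card ((\<lambda>i. - int i) ` rep_indices)"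
  proof (rule card_Un_disjoint)
    show "int ` rep_indices \<inter> (\<lambda>i. - int i) ` rep_indices = {}"
      by (auto simp: rep_indices_def)
  qed (simp_all add: rep_indices_def)
  also have "\<dots> = 2 * card rep_indices"
    by (simp add: card_image inj_on_def)
  finally show ?thesis .
qed

lemma card_rep_indices: "card rep_indices \<le> n"
proof -
  have "card rep_indices \<le> card {1..n}"
    by (rule card_mono) (auto simp: rep_indices_def)
  then show ?thesis
    by simp
qed

lemma partition_rank_eq: "partition_rank n P = real (n - card rep_indices)"
  using card_unlabelled_parts card_rep_indices by (simp add: partition_rank_def split_beta)

text \<open>The representative of i may be negative. Its opposite then represents the barred part,
  so its absolute value is always one of the free coordinates.\<close>

lemma rep_index:
  assumes i: "i \<in> {1..n}" and None: "snd P (block (int i)) = None"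
  shows "nat \<bar>rep (int i)\<bar> \<in> rep_indices"
proof -
  have k: "int i \<in> signed_set n"
    using i by (simp add: int_in_signed_set)
  let ?r = "rep (int i)"
  have r: "?r \<in> signed_set n" "snd P (block ?r) = None" "rep ?r = ?r"
    using rep_signed[OF k] block_rep[OF k] rep_rep[OF k] None by simp_all
  have "snd P (block \<bar>?r\<bar>) = None" "rep \<bar>?r\<bar> = \<bar>?r\<bar>"
    using r unlabelled_block_uminus[OF r(1,2)] rep_uminus[OF r(1,2)] by (simp_all add: abs_if)
  then show ?thesis
    using r(1) by (simp add: rep_indices_def signed_set_iff)
qed

text \<open>The coordinates in \<open>rep_indices\<close> are free. Each remaining coordinate is
  either a label, hence constant, or equal to a free coordinate up to inversion. In charts the
  latter relation is a holomorphic transition map, so the layer is locally the graph of a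
  holomorphic map, which a shear flattens.\<close>

lemma has_codim_layer: "has_codim X n (layer_of X n P) (n - card rep_indices)"
  unfolding has_codim_def
proof (intro conjI allI impI)
  show "n - card rep_indices \<le> n"
    by simp
  show "layer_of X n P \<subseteq> cartesian_power X n"
    using layer_ofD(1) by blast
  fix V :: "nat \<Rightarrow> complex set" and \<phi> a
  assume "(\<forall>i\<in>{1..n}. (V i, \<phi> i) \<in> params X) \<and> a \<in> {1..n} \<rightarrow>\<^sub>E UNIV \<and> (\<forall>i\<in>{1..n}. a i \<in> V i) \<and>
    (\<lambda>i\<in>{1..n}. \<phi> i (a i)) \<in> layer_of X n P"
  then have chart: "\<And>i. i \<in> {1..n} \<Longrightarrow> (V i, \<phi> i) \<in> params X" and a: "a \<in> {1..n} \<rightarrow>\<^sub>E UNIV"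
    and aV: "\<And>i. i \<in> {1..n} \<Longrightarrow> a i \<in> V i" and aP: "(\<lambda>i\<in>{1..n}. \<phi> i (a i)) \<in> layer_of X n P"
    by blast+
  define pt where "pt v = (\<lambda>i\<in>{1..n}. \<phi> i (v i))" for v
  have pt: "pt v \<in> cartesian_power X n" if "v \<in> Pi\<^sub>E {1..n} V" for v
    using params_closed[OF chart] that by (auto simp: pt_def cartesian_power_def PiE_iff)
  define B where "B = {1..n} - rep_indices"
  define lab where "lab i = snd P (block (int i))" for i
  define r where "r i = nat \<bar>rep (int i)\<bar>" for i
  define s where "s i p = (if 0 < rep (int i) then p else inv p)" for i p
  have r: "r i \<in> rep_indices" "r i \<in> {1..n}" if "i \<in> {1..n}" "lab i = None" for i
    using rep_index[of i] that by (auto simp: r_def lab_def rep_indices_def)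
  have retract_pt: "retract (pt v) i = (case lab i of Some z \<Rightarrow> z | None \<Rightarrow> s i (\<phi> (r i) (v (r i))))"
    if i: "i \<in> {1..n}" for v i
  proof (cases "lab i")
    case None
    have "coord X (pt v) (rep (int i)) = s i (pt v (r i))"
      by (auto simp: coord_def s_def r_def)
    also have "pt v (r i) = \<phi> (r i) (v (r i))"
      using r[OF i None] by (simp add: pt_def)
    finally show ?thesis
      using i None by (simp add: retract_def lab_def)
  next
    case (Some z)
    then show ?thesis
      using i by (simp add: retract_def lab_def)
  qed
  have on_layer: "pt v \<in> layer_of X n P \<longleftrightarrow> (\<forall>i\<in>B. \<phi> i (v i) =
      (case lab i of Some z \<Rightarrow> z | None \<Rightarrow> s i (\<phi> (r i) (v (r i)))))" if v: "v \<in> Pi\<^sub>E {1..n} V" for v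
  proof -
    \<comment> \<open>For a free coordinate \<open>r i\<close> = i and \<open>s i\<close> is the
      identity, so its fixed-point equation is trivial and only those in \<open>B\<close>
      remain.\<close>
    have "\<phi> i (v i) = (case lab i of Some z \<Rightarrow> z | None \<Rightarrow> s i (\<phi> (r i) (v (r i))))"
      if "i \<in> rep_indices" for i
      using that by (auto simp: rep_indices_def lab_def r_def s_def)
    then show ?thesis
      unfolding layer_iff_retract[OF pt[OF v]] using retract_pt
      by (auto simp: pt_def B_def)
  qed
  have a_eq: "\<phi> i (a i) = (case lab i of Some z \<Rightarrow> z | None \<Rightarrow> s i (\<phi> (r i) (a (r i))))" if "i \<in> B" for i
    using on_layer[of a] a aV aP that by (auto simp: pt_def PiE_iff)
  define Q where "Q i U \<tau> \<longleftrightarrow> open U \<and> a (r i) \<in> U \<and> U \<subseteq> V (r i) \<and> \<tau> holomorphic_on U \<and> \<tau> ` U \<subseteq> V i \<and>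
      (\<forall>u\<in>U. \<phi> i (\<tau> u) = s i (\<phi> (r i) u))" for i U \<tau>
  have "\<exists>U \<tau>. Q i U \<tau>" if i: "i \<in> B" "lab i = None" for i
    unfolding Q_def
  proof (rule params_transition[where \<phi> = "\<phi> (r i)" and \<phi>' = "\<phi> i" and a' = "a i"])
    have "i \<in> {1..n}"
      using i by (simp add: B_def)
    then show "(V (r i), \<phi> (r i)) \<in> params X" "(V i, \<phi> i) \<in> params X" "a (r i) \<in> V (r i)" "a i \<in> V i"
      using chart aV r i(2) by blast+
    show "s i = (\<lambda>p. p) \<or> s i = (\<lambda>p. inv p)"
      by (cases "0 < rep (int i)") (simp_all add: s_def fun_eq_iff)
    show "\<phi> i (a i) = s i (\<phi> (r i) (a (r i)))"
      using a_eq[OF i(1)] i(2) by simp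
  qed
  then obtain T \<tau> where Q: "\<And>i. i \<in> B \<Longrightarrow> lab i = None \<Longrightarrow> Q i (T i) (\<tau> i)"
    by metis
  have T: "open (T i)" "a (r i) \<in> T i" "\<tau> i holomorphic_on T i" "\<tau> i ` T i \<subseteq> V i"
      "\<And>u. u \<in> T i \<Longrightarrow> \<phi> i (\<tau> i u) = s i (\<phi> (r i) u)" if "i \<in> B" "lab i = None" for i
    using Q[OF that] unfolding Q_def by blast+
  \<comment> \<open>Several dependent coordinates may share the free coordinate j. Its domain is cut
    down to where all their transition maps are defined.\<close>
  define U where "U j = V j \<inter> \<Inter>(T ` {i \<in> B. lab i = None \<and> r i = j})" for j
  \<comment> \<open>A labelled coordinate is pinned to its value at the centre: \<open>a\<close>
    lies on the layer and the chart is injective, so \<open>a i\<close> is the only parameter of the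
    label in this chart.\<close>
  define h where "h i v = (if lab i = None then \<tau> i (v (r i)) else a i)" for i v
  have finB: "finite B"
    by (simp add: B_def)
  have openU: "open (U j)" if "j \<in> {1..n}" for j
    unfolding U_def using params_open[OF chart[OF that]] finB T(1) by (intro open_Int open_INT) auto
  have U_sub: "U j \<subseteq> V j" for j
    by (auto simp: U_def)
  have U_T: "U (r i) \<subseteq> T i" if "i \<in> B" "lab i = None" for i
    using that by (auto simp: U_def)
  have rB: "r i \<notin> B" "r i \<in> {1..n}" if "i \<in> B" "lab i = None" for i
    using r[of i] that by (auto simp: B_def)
  have "card B = n - card rep_indices"
    unfolding B_def by (subst card_Diff_subset) (auto simp: rep_indices_def)
  then obtain \<pi> where \<pi>: "\<pi> permutes {1..n}" "\<pi> ` {1..n - card rep_indices} = B"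
    using ex_permutes_image[of B n] by (auto simp: B_def)
  define \<psi> where "\<psi> v = (\<lambda>j\<in>{1..n}. if \<pi> j \<in> B then v (\<pi> j) - h (\<pi> j) v else v (\<pi> j))" for v
  have "\<exists>W. biholomorphic n (Pi\<^sub>E {1..n} U) W \<psi>"
    unfolding \<psi>_def
  proof (rule biholomorphic_shear[OF openU \<pi>(1)])
    show "holomorphic_fun n (\<Pi>\<^sub>E j\<in>{1..n}. if j \<in> B then UNIV else U j) (h i)" if i: "i \<in> B" for i
    proof (cases "lab i = None")
      case True
      have "holomorphic_fun n (\<Pi>\<^sub>E j\<in>{1..n}. if j \<in> B then UNIV else U j) (\<lambda>v. \<tau> i (v (r i)))"
      proof (rule holomorphic_fun_compose_coord[OF T(3)[OF i True] T(1)[OF i True] rB(2)[OF i True]])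
        fix v assume v: "v \<in> (\<Pi>\<^sub>E j\<in>{1..n}. if j \<in> B then UNIV else U j)"
        have "v (r i) \<in> (if r i \<in> B then UNIV else U (r i))"
          by (rule PiE_mem[OF v rB(2)[OF i True]])
        then have "v (r i) \<in> U (r i)"
          using rB(1)[OF i True] by simp
        then show "v (r i) \<in> T i"
          using U_T[OF i True] by blast
      qed
      then show ?thesis
        using True unfolding h_def by (simp only: if_True simp_thms)
    next
      case False
      then show ?thesis
        unfolding h_def by (simp only: if_False holomorphic_fun_const)
    qed
    show "h i v = h i v'" if "i \<in> B" "\<And>j. j \<in> {1..n} - B \<Longrightarrow> v j = v' j" for i v v'
      using that rB[of i] by (auto simp: h_def)
  qed
  then obtain W where W: "biholomorphic n (Pi\<^sub>E {1..n} U) W \<psi>"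
    by blast
  have aU: "a \<in> Pi\<^sub>E {1..n} U"
  proof -
    have "a j \<in> U j" if "j \<in> {1..n}" for j
      unfolding U_def using aV[OF that] T(2) by blast
    then show ?thesis
      using a unfolding PiE_iff by blast
  qed
  have UV: "Pi\<^sub>E {1..n} U \<subseteq> Pi\<^sub>E {1..n} V"
    using U_sub by (rule PiE_mono)
  have "pt v \<in> layer_of X n P \<longleftrightarrow> (\<forall>j\<in>{1..n - card rep_indices}. \<psi> v j = 0)" if v: "v \<in> Pi\<^sub>E {1..n} U" for v
  proof -
    have vV: "v \<in> Pi\<^sub>E {1..n} V"
      using v UV by blast
    have "\<phi> i (v i) = (case lab i of Some z \<Rightarrow> z | None \<Rightarrow> s i (\<phi> (r i) (v (r i)))) \<longleftrightarrow> v i - h i v = 0"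
      if i: "i \<in> B" for i
    proof -
      have iV: "v i \<in> V i" and i': "i \<in> {1..n}"
        using vV i by (auto simp: B_def)
      have "(case lab i of Some z \<Rightarrow> z | None \<Rightarrow> s i (\<phi> (r i) (v (r i)))) = \<phi> i (h i v) \<and> h i v \<in> V i"
      proof (cases "lab i")
        case None
        have "v (r i) \<in> T i"
          using U_T[OF i None] v rB[OF i None] by (auto simp: PiE_iff)
        then show ?thesis
          using T(4,5)[OF i None] None by (auto simp: h_def)
      next
        case (Some z)
        then show ?thesis
          using a_eq[OF i] aV[OF i'] by (simp add: h_def)
      qed
      then show ?thesis
        using inj_on_eq_iff[OF params_inj[OF chart[OF i']] iV, of "h i v"] by simp
    qed
    then have "pt v \<in> layer_of X n P \<longleftrightarrow> (\<forall>i\<in>B. v i - h i v = 0)"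
      unfolding on_layer[OF vV] by blast
    also have "\<dots> \<longleftrightarrow> (\<forall>j\<in>{1..n - card rep_indices}. v (\<pi> j) - h (\<pi> j) v = 0)"
      unfolding \<pi>(2)[symmetric] by (rule ball_simps)
    also have "\<dots> \<longleftrightarrow> (\<forall>j\<in>{1..n - card rep_indices}. \<psi> v j = 0)"
    proof (rule ball_cong[OF refl])
      fix j assume "j \<in> {1..n - card rep_indices}"
      then have "\<pi> j \<in> B" "j \<in> {1..n}"
        using \<pi>(2) by auto
      then show "v (\<pi> j) - h (\<pi> j) v = 0 \<longleftrightarrow> \<psi> v j = 0"
        by (simp add: \<psi>_def)
    qed
    finally show ?thesis .
  qed
  then show "\<exists>U W \<psi>. a \<in> U \<and> U \<subseteq> Pi\<^sub>E {1..n} V \<and> biholomorphic n U W \<psi> \<and>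
      (\<forall>v\<in>U. (\<lambda>i\<in>{1..n}. \<phi> i (v i)) \<in> layer_of X n P \<longleftrightarrow> (\<forall>i\<in>{1..n - card rep_indices}. \<psi> v i = 0))"
    using aU UV W unfolding pt_def by blast
qed

lemma has_codim_layer_iff: "has_codim X n (layer_of X n P) k \<longleftrightarrow> real k = partition_rank n P"
proof -
  obtain y where y: "y \<in> layer_of X n P"
    using layer_nonempty by blast
  show ?thesis
    unfolding partition_rank_eq of_nat_eq_iff
    using has_codim_le[OF _ has_codim_layer y] has_codim_le[OF has_codim_layer _ y] has_codim_layer
    by (metis order_antisym)
qed

end

context curve
begin

theorem ranked_poset_iso_layer_of: "ranked_poset_iso X R n (layer_of X n)"
  unfolding ranked_poset_iso_def
proof (intro conjI ballI allI)
  show "bij_betw (layer_of X n) (label_partitions X R n) (layers X R n)"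
    unfolding bij_betw_def layers_eq
    using inj_on_subset[OF inj_on_layer_of] label_partitions_symmetric by blast
  show "partition_le X n P Q \<longleftrightarrow> layer_le (layer_of X n P) (layer_of X n Q)"
    if "P \<in> label_partitions X R n" "Q \<in> label_partitions X R n" for P Q
    using partition_le_iff_layer_le that label_partitions_symmetric by blast
  show "has_codim X n (layer_of X n P) k \<longleftrightarrow> real k = partition_rank n P"
    if P: "P \<in> label_partitions X R n" for P k
  proof -
    interpret curve_partition X n P
      by unfold_locales (rule label_partitions_symmetric[OF P])
    show ?thesis
      by (rule has_codim_layer_iff)
  qed
qed

theorem hyperoctahedral_equivariant_layer_of: "hyperoctahedral_equivariant X R n (layer_of X n)"
  unfolding hyperoctahedral_equivariant_def
  using act_partition_in_label_partitions layer_of_act_partition label_partitions_symmetric by blast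

end

section \<open>The three families of groups\<close>

lemma additive_line_simps [simp]:
  "carrier additive_line = UNIV" "monoid.mult additive_line = (+)" "one additive_line = 0"
  "curve_top additive_line = euclidean" "params additive_line = {(UNIV, \<lambda>z. z)}"
  by (simp_all add: additive_line_def)

lemma group_additive_line: "group additive_line"
  by (rule groupI) (auto simp: add.assoc intro: exI[of _ "- _"])

lemma inv_additive_line [simp]: "inv\<^bsub>additive_line\<^esub> z = - z"
  by (rule group.inv_equality[OF group_additive_line]) simp_all

lemma connected_space_top_of_set: "connected_space (top_of_set S) \<longleftrightarrow> connected S"
  using connectedin_def[of euclidean S] by simp

lemma t1_space_top_of_set: "t1_space (top_of_set (S :: 'a :: t1_space set))"
  unfolding t1_space_closedin_singleton by (auto intro: closed_subset)

lemma curve_additive_line: "curve additive_line"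
proof (intro curve.intro curve_axioms.intro group_additive_line)
  show "connected_space (curve_top additive_line)"
    using connected_space_top_of_set[of "UNIV :: complex set"] convex_connected[OF convex_UNIV] by simp
  show "t1_space (curve_top additive_line)"
    using t1_space_top_of_set[of "UNIV :: complex set"] by simp
  show "continuous_map (curve_top additive_line) (curve_top additive_line) (\<lambda>x. inv\<^bsub>additive_line\<^esub> x)"
    by (simp add: continuous_on_minus continuous_on_id)
  have "two_torsion additive_line = {0}"
    by (auto simp: two_torsion_def)
  then show "finite (two_torsion additive_line)"
    by simp
  show "\<exists>U \<tau>. open U \<and> a \<in> U \<and> U \<subseteq> V \<and> \<tau> holomorphic_on U \<and> \<tau> ` U \<subseteq> V' \<and> (\<forall>u\<in>U. \<phi>' (\<tau> u) = s (\<phi> u))"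
    if "(V, \<phi>) \<in> params additive_line" "(V', \<phi>') \<in> params additive_line"
      "s = (\<lambda>p. p) \<or> s = (\<lambda>p. inv\<^bsub>additive_line\<^esub> p)"
    for V V' \<phi> \<phi>' a s
  proof (intro exI[of _ UNIV] exI[of _ s] conjI)
    show "s holomorphic_on UNIV"
      using that(3) by (auto intro: holomorphic_intros)
  qed (use that in auto)
qed auto

section \<open>The multiplicative group of nonzero complex numbers\<close>

lemma punctured_line_simps [simp]:
  "carrier punctured_line = - {0}" "monoid.mult punctured_line = (*)" "one punctured_line = 1"
  "curve_top punctured_line = top_of_set (- {0})" "params punctured_line = {(- {0}, \<lambda>z. z)}"
  by (simp_all add: punctured_line_def)

lemma group_punctured_line: "group punctured_line"
proof (rule groupI)
  show "\<exists>y\<in>carrier punctured_line. y \<otimes>\<^bsub>punctured_line\<^esub> x = \<one>\<^bsub>punctured_line\<^esub>"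
    if "x \<in> carrier punctured_line" for x
    using that by (intro bexI[of _ "inverse x"]) auto
qed (auto simp: mult.assoc)

lemma inv_punctured_line: "z \<noteq> 0 \<Longrightarrow> inv\<^bsub>punctured_line\<^esub> z = inverse z"
  by (rule group.inv_equality[OF group_punctured_line]) simp_all

lemma curve_punctured_line: "curve punctured_line"
proof (intro curve.intro curve_axioms.intro group_punctured_line)
  show "connected_space (curve_top punctured_line)"
    using connected_punctured_universe[of "0 :: complex"] by (simp add: connected_space_top_of_set)
  show "t1_space (curve_top punctured_line)"
    by (simp add: t1_space_top_of_set)
  have "continuous_map (top_of_set (- {0})) (top_of_set (- {0 :: complex})) inverse"
    by (auto simp: continuous_map_in_subtopology intro!: continuous_intros)
  then show "continuous_map (curve_top punctured_line) (curve_top punctured_line) (\<lambda>x. inv\<^bsub>punctured_line\<^esub> x)"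
    unfolding punctured_line_simps by (rule continuous_map_eq) (simp add: inv_punctured_line)
  have "two_torsion punctured_line \<subseteq> {1, - 1}"
  proof
    fix z assume "z \<in> two_torsion punctured_line"
    then have "z \<noteq> 0" "z = inverse z"
      by (auto simp: two_torsion_def inv_punctured_line)
    then have "z * z = 1"
      by (metis right_inverse)
    then show "z \<in> {1, - 1}"
      using square_eq_1_iff by auto
  qed
  then show "finite (two_torsion punctured_line)"
    by (rule finite_subset) simp
  show "\<exists>U \<tau>. open U \<and> a \<in> U \<and> U \<subseteq> V \<and> \<tau> holomorphic_on U \<and> \<tau> ` U \<subseteq> V' \<and> (\<forall>u\<in>U. \<phi>' (\<tau> u) = s (\<phi> u))"
    if V: "(V, \<phi>) \<in> params punctured_line" "(V', \<phi>') \<in> params punctured_line" and a: "a \<in> V"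
      and s: "s = (\<lambda>p. p) \<or> s = (\<lambda>p. inv\<^bsub>punctured_line\<^esub> p)"
    for V V' \<phi> \<phi>' a s
  proof -
    \<comment> \<open>The group inverse is identified with \<open>inverse\<close> only at nonzero
      points. Hence \<tau> is a concrete holomorphic function that agrees with \<open>s\<close>
      there.\<close>
    define \<tau> :: "complex \<Rightarrow> complex" where "\<tau> = (if s = (\<lambda>p. p) then (\<lambda>z. z) else inverse)"
    have "\<tau> holomorphic_on - {0}"
      by (auto simp: \<tau>_def intro!: holomorphic_intros)
    moreover have \<tau>: "\<tau> u = s u" "\<tau> u \<noteq> 0" if "u \<noteq> 0" for u
      using s that by (cases "s = (\<lambda>p. p)"; simp add: \<tau>_def inv_punctured_line)+
    moreover have eqs: "V = - {0}" "V' = - {0}" "\<phi> = (\<lambda>z. z)" "\<phi>' = (\<lambda>z. z)"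
      using V unfolding punctured_line_simps singleton_iff prod.inject by blast+
    moreover have "\<tau> ` (- {0}) \<subseteq> - {0}"
    proof (rule image_subsetI)
      show "\<tau> u \<in> - {0}" if "u \<in> - {0}" for u
        using \<tau>(2)[of u] that by simp
    qed
    ultimately have "open (- {0 :: complex}) \<and> a \<in> - {0} \<and> - {0} \<subseteq> V \<and> \<tau> holomorphic_on - {0} \<and>
        \<tau> ` (- {0}) \<subseteq> V' \<and> (\<forall>u\<in>- {0}. \<phi>' (\<tau> u) = s (\<phi> u))"
      using a \<tau>(1) by (simp add: open_Compl)
    then show ?thesis
      by blast
  qed
qed auto

section \<open>Complex elliptic curves\<close>

locale lattice =
  fixes \<omega>1 \<omega>2 :: complex
  assumes independent: "\<omega>2 / \<omega>1 \<notin> \<real>"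
begin

abbreviation "\<Lambda> \<equiv> period_lattice \<omega>1 \<omega>2"

abbreviation "E \<equiv> elliptic_curve \<Lambda>"

abbreviation "proj \<equiv> lattice_proj \<Lambda>"

lemma zero_in_lattice: "0 \<in> \<Lambda>"
  by (auto simp: period_lattice_def intro!: exI[of _ 0])

lemma add_in_lattice: "x \<in> \<Lambda> \<Longrightarrow> y \<in> \<Lambda> \<Longrightarrow> x + y \<in> \<Lambda>"
proof -
  assume "x \<in> \<Lambda>" "y \<in> \<Lambda>"
  then obtain a b c d where "x = of_int a * \<omega>1 + of_int b * \<omega>2" "y = of_int c * \<omega>1 + of_int d * \<omega>2"
    by (auto simp: period_lattice_def)
  then have "x + y = of_int (a + c) * \<omega>1 + of_int (b + d) * \<omega>2"
    by (simp add: algebra_simps)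
  then show ?thesis
    unfolding period_lattice_def by blast
qed

lemma minus_in_lattice: "x \<in> \<Lambda> \<Longrightarrow> - x \<in> \<Lambda>"
proof -
  assume "x \<in> \<Lambda>"
  then obtain a b where "x = of_int a * \<omega>1 + of_int b * \<omega>2"
    by (auto simp: period_lattice_def)
  then have "- x = of_int (- a) * \<omega>1 + of_int (- b) * \<omega>2"
    by (simp add: algebra_simps)
  then show ?thesis
    unfolding period_lattice_def by blast
qed

lemma diff_in_lattice: "x \<in> \<Lambda> \<Longrightarrow> y \<in> \<Lambda> \<Longrightarrow> x - y \<in> \<Lambda>"
  using add_in_lattice[OF _ minus_in_lattice, of x y] by simp

lemma proj_def: "proj z = (\<lambda>l. l + z) ` \<Lambda>"
  by (auto simp: r_coset_def complex_group_def)

lemma proj_eq_iff: "proj z = proj w \<longleftrightarrow> z - w \<in> \<Lambda>"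
proof
  assume "proj z = proj w"
  moreover have "z \<in> proj z"
    unfolding proj_def using zero_in_lattice by (intro image_eqI[of _ _ 0]) auto
  ultimately show "z - w \<in> \<Lambda>"
    by (auto simp: proj_def)
next
  have sub: "proj z \<subseteq> proj w" if "z - w \<in> \<Lambda>" for z w
  proof
    fix x assume "x \<in> proj z"
    then obtain l where "l \<in> \<Lambda>" "x = l + z"
      by (auto simp: proj_def)
    then show "x \<in> proj w"
      unfolding proj_def using add_in_lattice[OF _ that] by (intro image_eqI[of _ _ "l + (z - w)"]) auto
  qed
  assume "z - w \<in> \<Lambda>"
  then show "proj z = proj w"
    using sub[of z w] sub[of w z] minus_in_lattice[of "z - w"] by simp
qed

lemma carrier_elliptic [simp]: "carrier E = range proj"
  by (auto simp: elliptic_curve_def FactGroup_def RCOSETS_def complex_group_def)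

lemma mult_elliptic [simp]: "proj z \<otimes>\<^bsub>E\<^esub> proj w = proj (z + w)"
proof -
  have "proj z \<otimes>\<^bsub>E\<^esub> proj w = {x + y |x y. x \<in> proj z \<and> y \<in> proj w}"
    by (auto simp: elliptic_curve_def FactGroup_def set_mult_def complex_group_def)
  also have "\<dots> = proj (z + w)"
  proof (intro equalityI subsetI)
    fix v assume "v \<in> {x + y |x y. x \<in> proj z \<and> y \<in> proj w}"
    then obtain k l where "k \<in> \<Lambda>" "l \<in> \<Lambda>" "v = (k + z) + (l + w)"
      by (auto simp: proj_def)
    then show "v \<in> proj (z + w)"
      unfolding proj_def using add_in_lattice by (intro image_eqI[of _ _ "k + l"]) auto
  next
    fix v assume "v \<in> proj (z + w)"
    then obtain k where "k \<in> \<Lambda>" "v = (k + z) + (0 + w)"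
      by (auto simp: proj_def)
    then show "v \<in> {x + y |x y. x \<in> proj z \<and> y \<in> proj w}"
      unfolding proj_def using zero_in_lattice by blast
  qed
  finally show ?thesis .
qed

lemma one_elliptic [simp]: "\<one>\<^bsub>E\<^esub> = proj 0"
  by (simp add: elliptic_curve_def FactGroup_def proj_def)

lemma group_elliptic: "group E"
proof (rule groupI)
  show "\<exists>y\<in>carrier E. y \<otimes>\<^bsub>E\<^esub> x = \<one>\<^bsub>E\<^esub>" if x: "x \<in> carrier E" for x
  proof -
    obtain z where "x = proj z"
      using x by auto
    then have "proj (- z) \<otimes>\<^bsub>E\<^esub> x = \<one>\<^bsub>E\<^esub>"
      by simp
    then show ?thesis
      by auto
  qed
qed (auto simp: add.assoc)

lemma inv_elliptic [simp]: "inv\<^bsub>E\<^esub> (proj z) = proj (- z)"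
  by (rule group.inv_equality[OF group_elliptic]) simp_all

text \<open>Write a nonzero period as \<omega>1 (a + b q) with q = \<omega>2 / \<omega>1 non-real.
  If b = 0 the second factor has modulus at least 1, otherwise at least |Im q|; this gives the
  constant.\<close>

lemma lattice_discrete: "\<exists>\<delta>>0. \<forall>l\<in>\<Lambda>. l \<noteq> 0 \<longrightarrow> \<delta> \<le> norm l"
proof -
  define q where "q = \<omega>2 / \<omega>1"
  have \<omega>1: "\<omega>1 \<noteq> 0"
    using independent by auto
  then have q: "\<omega>2 = \<omega>1 * q"
    by (simp add: q_def)
  have Im: "Im q \<noteq> 0"
    using independent by (simp add: q_def complex_is_Real_iff)
  let ?\<delta> = "norm \<omega>1 * min 1 \<bar>Im q\<bar>"
  have "?\<delta> \<le> norm l" if l: "l \<in> \<Lambda>" "l \<noteq> 0" for l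
  proof -
    obtain a b where ab: "l = of_int a * \<omega>1 + of_int b * \<omega>2"
      using l(1) by (auto simp: period_lattice_def)
    then have norm: "norm l = norm \<omega>1 * norm (of_int a + of_int b * q)"
      by (simp add: q norm_mult[symmetric] algebra_simps)
    have "min 1 \<bar>Im q\<bar> \<le> norm (of_int a + of_int b * q)"
    proof (cases "b = 0")
      case True
      then have "a \<noteq> 0"
        using ab l(2) by auto
      then have "1 \<le> \<bar>real_of_int a\<bar>"
        by linarith
      then show ?thesis
        using True by simp
    next
      case False
      then have "1 \<le> \<bar>real_of_int b\<bar>"
        by linarith
      then have "\<bar>Im q\<bar> \<le> \<bar>real_of_int b\<bar> * \<bar>Im q\<bar>"
        using mult_right_mono[of 1 "\<bar>real_of_int b\<bar>" "\<bar>Im q\<bar>"] by simp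
      also have "\<dots> = \<bar>Im (of_int a + of_int b * q)\<bar>"
        by (simp add: abs_mult)
      also have "\<dots> \<le> norm (of_int a + of_int b * q)"
        by (rule abs_Im_le_cmod)
      finally show ?thesis
        by simp
    qed
    then show ?thesis
      unfolding norm by (rule mult_left_mono) simp
  qed
  moreover have "0 < ?\<delta>"
    using \<omega>1 Im by simp
  ultimately show ?thesis
    by blast
qed

text \<open>The preimage of a point of the quotient is a translate of \<Lambda>, so closedness of
  \<Lambda> makes the points of the curve closed.\<close>

lemma closed_lattice: "closed \<Lambda>"
proof -
  obtain \<delta> where \<delta>: "0 < \<delta>" "\<forall>l\<in>\<Lambda>. l \<noteq> 0 \<longrightarrow> \<delta> \<le> norm l"
    using lattice_discrete by blast
  show ?thesis
  proof (rule discrete_imp_closed[OF \<delta>(1)], intro ballI impI)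
    fix x y assume "x \<in> \<Lambda>" "y \<in> \<Lambda>" "dist y x < \<delta>"
    then show "y = x"
      using \<delta>(2) diff_in_lattice[of y x] by (force simp: dist_norm)
  qed
qed

lemma openin_elliptic: "openin (curve_top E) U \<longleftrightarrow> U \<subseteq> range proj \<and> open {z. proj z \<in> U}"
  by (simp add: elliptic_curve_def openin_quotient_topology)

lemma topspace_elliptic: "topspace (curve_top E) = range proj"
proof -
  have "openin (curve_top E) (range proj)"
    by (simp add: openin_elliptic)
  then show ?thesis
    using openin_subset openin_elliptic openin_topspace by blast
qed

lemma continuous_proj: "continuous_map euclidean (curve_top E) proj"
  by (simp add: continuous_map_def topspace_elliptic openin_elliptic)

lemma params_elliptic: "params E = {(V, proj) |V. open V \<and> inj_on proj V}"
  by (simp add: elliptic_curve_def)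

text \<open>A two-torsion point is the class of a half period, and its two integer coefficients
  matter only modulo 2.\<close>

lemma finite_two_torsion_elliptic: "finite (two_torsion E)"
proof -
  let ?h = "\<lambda>(a :: int, b :: int). proj ((of_int a * \<omega>1 + of_int b * \<omega>2) / 2)"
  have "two_torsion E \<subseteq> ?h ` ({0..1} \<times> {0..1})"
  proof
    fix x assume "x \<in> two_torsion E"
    then obtain z where z: "x = proj z" "proj z = proj (- z)"
      by (auto simp: two_torsion_def)
    then have "2 * z \<in> \<Lambda>"
      using proj_eq_iff[of z "- z"] by simp
    then obtain a b where "2 * z = of_int a * \<omega>1 + of_int b * \<omega>2"
      by (auto simp: period_lattice_def)
    then have ab: "z = (of_int a * \<omega>1 + of_int b * \<omega>2) / 2"
      by (simp add: field_simps)
    have "of_int c = of_int (c mod 2) + 2 * (of_int (c div 2) :: complex)" for c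
      by (metis mult_div_mod_eq add.commute of_int_add of_int_mult of_int_numeral)
    from this[of a] this[of b]
    have "z - (of_int (a mod 2) * \<omega>1 + of_int (b mod 2) * \<omega>2) / 2 = of_int (a div 2) * \<omega>1 + of_int (b div 2) * \<omega>2"
      unfolding ab by (simp add: field_simps)
    then have "x = ?h (a mod 2, b mod 2)"
      unfolding z(1) by (simp add: proj_eq_iff) (auto simp: period_lattice_def)
    moreover have "a mod 2 \<in> {0..1}" "b mod 2 \<in> {0..1}"
      by auto
    ultimately show "x \<in> ?h ` ({0..1} \<times> {0..1})"
      by blast
  qed
  then show ?thesis
    by (rule finite_subset) simp
qed

text \<open>Two points of a ball of radius \<delta>/2 are less than \<delta> apart, so they cannot
  differ by a nonzero period.\<close>

lemma params_cover_elliptic: "\<exists>V. (V, proj) \<in> params E \<and> z \<in> V"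
proof -
  obtain \<delta> where \<delta>: "0 < \<delta>" "\<forall>l\<in>\<Lambda>. l \<noteq> 0 \<longrightarrow> \<delta> \<le> norm l"
    using lattice_discrete by blast
  have "inj_on proj (ball z (\<delta> / 2))"
  proof (rule inj_onI)
    fix v w assume "v \<in> ball z (\<delta> / 2)" "w \<in> ball z (\<delta> / 2)" and eq: "proj v = proj w"
    then have "norm (v - w) < \<delta>"
      using dist_triangle_half_r[of z v \<delta> w] by (simp add: dist_norm)
    then show "v = w"
      using \<delta>(2) eq unfolding proj_eq_iff by force
  qed
  then show ?thesis
    using \<delta>(1) unfolding params_elliptic by (intro exI[of _ "ball z (\<delta> / 2)"]) auto
qed

lemma params_transition_elliptic:
  assumes V: "(V, \<phi>) \<in> params E" "(V', \<phi>') \<in> params E" and a: "a \<in> V" "a' \<in> V'"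
    and s: "s = (\<lambda>p. p) \<or> s = (\<lambda>p. inv\<^bsub>E\<^esub> p)" and eq: "\<phi>' a' = s (\<phi> a)"
  shows "\<exists>U \<tau>. open U \<and> a \<in> U \<and> U \<subseteq> V \<and> \<tau> holomorphic_on U \<and> \<tau> ` U \<subseteq> V' \<and> (\<forall>u\<in>U. \<phi>' (\<tau> u) = s (\<phi> u))"
proof -
  have \<phi>: "\<phi> = proj" "\<phi>' = proj" "open V" "open V'"
    using V by (auto simp: params_elliptic)
  obtain c where c: "\<And>z. s (proj z) = proj (c * z)"
  proof (cases "s = (\<lambda>p. p)")
    case True
    then show thesis
      using that[of 1] by simp
  next
    case False
    then show thesis
      using s that[of "- 1"] by simp
  qed
  \<comment> \<open>The map z to c z lifts \<open>s\<close> to the plane, but may send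
    \<open>a\<close> to another representative of the class of a'. The correction a' - c a is a
    period, so the translated lift still covers \<open>s\<close> and sends \<open>a\<close> to
    a'.\<close>
  let ?\<tau> = "\<lambda>u. c * u + (a' - c * a)"
  have "open (?\<tau> -` V')"
    by (intro open_vimage \<phi> continuous_intros)
  moreover have "proj (?\<tau> u) = s (proj u)" for u
    using eq unfolding \<phi> c proj_eq_iff by simp
  moreover have "?\<tau> holomorphic_on V \<inter> ?\<tau> -` V'"
    by (intro holomorphic_intros)
  ultimately show ?thesis
    using \<phi> a by (intro exI[of _ "V \<inter> ?\<tau> -` V'"] exI[of _ ?\<tau>]) auto
qed

lemma curve_elliptic: "curve E"
proof (intro curve.intro curve_axioms.intro group_elliptic)
  show "topspace (curve_top E) = carrier E"
    by (simp add: topspace_elliptic)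
  have "connectedin (curve_top E) (range proj)"
    by (rule connectedin_continuous_map_image[OF continuous_proj]) (simp add: convex_connected)
  then show "connected_space (curve_top E)"
    by (metis connectedin_topspace topspace_elliptic)
  have "closedin (curve_top E) {proj z}" for z
  proof -
    have "{w. proj w \<in> range proj - {proj z}} = - ((+) z ` \<Lambda>)"
    proof -
      have "proj w = proj z \<longleftrightarrow> w \<in> (+) z ` \<Lambda>" for w
        unfolding proj_eq_iff by (auto simp: image_iff intro: bexI[of _ "w - z"])
      then show ?thesis
        by blast
    qed
    then have "openin (curve_top E) (range proj - {proj z})"
      using closed_translation[OF closed_lattice] by (auto simp: openin_elliptic open_Compl)
    then show ?thesis
      by (simp add: closedin_def topspace_elliptic)
  qed
  then show "t1_space (curve_top E)"
    by (auto simp: t1_space_closedin_singleton topspace_elliptic)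
  show "continuous_map (curve_top E) (curve_top E) (\<lambda>x. inv\<^bsub>E\<^esub> x)"
    unfolding continuous_map_def
  proof (intro conjI allI impI)
    show "(\<lambda>x. inv\<^bsub>E\<^esub> x) \<in> topspace (curve_top E) \<rightarrow> topspace (curve_top E)"
      by (auto simp: topspace_elliptic)
    fix U assume "openin (curve_top E) U"
    then have "open (uminus -` {z. proj z \<in> U})"
      by (intro open_vimage continuous_intros) (simp add: openin_elliptic)
    moreover have "uminus -` {z. proj z \<in> U} = {z. proj z \<in> {x \<in> topspace (curve_top E). inv\<^bsub>E\<^esub> x \<in> U}}"
      by (auto simp: topspace_elliptic)
    ultimately show "openin (curve_top E) {x \<in> topspace (curve_top E). inv\<^bsub>E\<^esub> x \<in> U}"
      unfolding openin_elliptic by (auto simp: topspace_elliptic)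
  qed
  show "\<exists>V \<phi> a. (V, \<phi>) \<in> params E \<and> a \<in> V \<and> \<phi> a = p" if "p \<in> carrier E" for p
    using that params_cover_elliptic by fastforce
  show "finite (two_torsion E)"
    by (rule finite_two_torsion_elliptic)
  show "open V" "inj_on \<phi> V" if "(V, \<phi>) \<in> params E" for V \<phi>
    using that by (auto simp: params_elliptic)
  show "\<phi> a \<in> carrier E" if "(V, \<phi>) \<in> params E" for V \<phi> a
    using that by (auto simp: params_elliptic)
  show "\<exists>U \<tau>. open U \<and> a \<in> U \<and> U \<subseteq> V \<and> \<tau> holomorphic_on U \<and> \<tau> ` U \<subseteq> V' \<and> (\<forall>u\<in>U. \<phi>' (\<tau> u) = s (\<phi> u))"
    if "(V, \<phi>) \<in> params E" "(V', \<phi>') \<in> params E" "a \<in> V" "a' \<in> V'"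
      "s = (\<lambda>p. p) \<or> s = (\<lambda>p. inv\<^bsub>E\<^esub> p)" "\<phi>' a' = s (\<phi> a)"
    for V V' \<phi> \<phi>' a a' s
    by (rule params_transition_elliptic[OF that])
qed

end

theorem theorem3p7:
  fixes n :: nat and R :: root_type
  assumes "n \<ge> 1"
  shows "(\<exists>F. ranked_poset_iso additive_line R n F \<and>
              hyperoctahedral_equivariant additive_line R n F) \<and>
         (\<exists>F. ranked_poset_iso punctured_line R n F \<and>
              hyperoctahedral_equivariant punctured_line R n F) \<and>
         (\<forall>\<omega>1 \<omega>2. \<omega>2 / \<omega>1 \<notin> \<real> \<longrightarrow>
            (\<exists>F. ranked_poset_iso (elliptic_curve (period_lattice \<omega>1 \<omega>2)) R n F \<and>
                 hyperoctahedral_equivariant (elliptic_curve (period_lattice \<omega>1 \<omega>2)) R n F))"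
proof (intro conjI allI impI)
  fix \<omega>1 \<omega>2 :: complex
  assume "\<omega>2 / \<omega>1 \<notin> \<real>"
  then interpret lattice \<omega>1 \<omega>2
    by unfold_locales
  show "\<exists>F. ranked_poset_iso (elliptic_curve (period_lattice \<omega>1 \<omega>2)) R n F \<and>
      hyperoctahedral_equivariant (elliptic_curve (period_lattice \<omega>1 \<omega>2)) R n F"
    using curve.ranked_poset_iso_layer_of[OF curve_elliptic]
      curve.hyperoctahedral_equivariant_layer_of[OF curve_elliptic] by blast
qed (use curve.ranked_poset_iso_layer_of[OF curve_additive_line]
    curve.hyperoctahedral_equivariant_layer_of[OF curve_additive_line]
    curve.ranked_poset_iso_layer_of[OF curve_punctured_line]
    curve.hyperoctahedral_equivariant_layer_of[OF curve_punctured_line] in blast)+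

end
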